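(* Let $\epsilon\in\{1,-1\}$, let $g_0=(g_{0\,\alpha\beta})$ be a constant real symmetric invertible $2\times 2$ matrix, and let $\phi=\phi(x^1,x^2)$ be a smooth real function on an open set $U\subseteq\mathbb{R}^2$ whose graph $S_0=\{x^3=\phi(x^1,x^2)\}$ is a minimal surface in the three-dimensional flat manifold $M_3$ with metric $g_{0\,\mu\nu}dx^\mu dx^\nu+\epsilon (dx^3)^2$ (that is, $h^{\mu\nu}\phi_{,\mu\nu}=0$ with $h$ as in the context). Set $$w_1=(g_0)_{11}+\epsilon(\phi_{,1})^2,\qquad w_2=(g_0)_{22}+\epsilon(\phi_{,2})^2,$$ and assume $\rho>0$, $w_1>0$, $w_2>0$ on $U$. Let $n\ge 1$ be an integer, let $\epsilon_1,\dots,\epsilon_n\in\{1,-1\}$, and let $e_0,m_1,m_2,n_1,n_2$ be real constants with $$m_1+m_2=0,\qquad n_1+n_2=\frac{n-1}{2}.$$ Define $\psi$ and $\Phi$ on $U$ by $$e^{2\psi}=e^{2e_0\phi}\,w_1^{-2m_1}\,w_2^{-2m_2},\qquad e^{2\Phi}=e^{2\psi}\,w_1^{-2n_1}\,w_2^{-2n_2}\,\rho^{\,n_1+n_2}.$$ Then the $(2+2n)$-dimensional (pseudo-)Riemannian metric on $U\times\mathbb{R}^{2n}$, with coordinates $(x^\alpha,y_1^\alpha,\dots,y_n^\alpha)$, $\alpha=1,2$, $$ds^2=e^{2\Phi}\,g_{\alpha\beta}\,dx^\alpha dx^\beta+\epsilon_1\,g_{\alpha\beta}\,dy_1^\alpha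 dy_1^\beta+\cdots+\epsilon_n\,g_{\alpha\beta}\,dy_n^\alpha dy_n^\beta,$$ where $g_{\alpha\beta}=g_{\alpha\beta}(x^1,x^2)$ is the metric $g=h/\sqrt{\rho}$ defined in the context, is Ricci flat.
   Context: Greek indices run over $1,2$, repeated indices are summed, commas denote partial derivatives with respect to $x^1,x^2$, and $g_0^{\mu\nu}$ are the entries of $g_0^{-1}$. The metric induced on the graph $S_0$ is $h_{\mu\nu}=g_{0\,\mu\nu}+\epsilon\,\phi_{,\mu}\phi_{,\nu}$. Put $\rho=1+\epsilon\,g_0^{\mu\nu}\phi_{,\mu}\phi_{,\nu}$, so $\det h=\rho\det g_0$. The inverse of $h$ is denoted $h^{\mu\nu}$. The mean curvature is $H=\rho^{-1/2}h^{\mu\nu}\phi_{,\mu\nu}$ and $S_0$ is called minimal if $H=0$. The locally conformal surface $S$ carries the metric $g_{\alpha\beta}=h_{\alpha\beta}/\sqrt{\rho}$, for which $\det g=\det g_0$. *)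

theory Defs
  imports "HOL-Analysis.Analysis"
begin

section \<open>Smooth functions on \<open>\<real>\<^sup>N\<close>\<close>

definition partial_deriv ::
    "'i::finite \<Rightarrow> (real ^ 'i \<Rightarrow> real) \<Rightarrow> real ^ 'i \<Rightarrow> real" where
  "partial_deriv i f x = deriv (\<lambda>t. f (x + t *\<^sub>R axis i 1)) 0"

primrec Ck_on :: "nat \<Rightarrow> (real ^ 'i::finite) set \<Rightarrow> (real ^ 'i \<Rightarrow> real) \<Rightarrow> bool" where
  "Ck_on 0 U f \<longleftrightarrow> continuous_on U f"
| "Ck_on (Suc k) U f \<longleftrightarrow>
     (\<forall>x\<in>U. f differentiable (at x)) \<and> (\<forall>i. Ck_on k U (partial_deriv i f))"

text \<open>Only meant for open \<open>U\<close>.\<close>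

definition smooth_on :: "(real ^ 'i::finite) set \<Rightarrow> (real ^ 'i \<Rightarrow> real) \<Rightarrow> bool" where
  "smooth_on U f \<longleftrightarrow> (\<forall>k. Ck_on k U f)"


section \<open>Pseudo-Riemannian metrics in global coordinates\<close>

type_synonym 'i metric = "real ^ 'i \<Rightarrow> real ^ 'i ^ 'i"

definition pseudo_riemannian_metric_on ::
    "(real ^ 'i::finite) set \<Rightarrow> 'i metric \<Rightarrow> bool" where
  "pseudo_riemannian_metric_on W G \<longleftrightarrow>
     (\<forall>i j. smooth_on W (\<lambda>x. G x $ i $ j)) \<and>
     (\<forall>x\<in>W. transpose (G x) = G x \<and> invertible (G x))"

text \<open>\<open>christoffel G k i j\<close> is \<open>\<Gamma>\<^sup>k\<^sub>i\<^sub>j\<close>.\<close>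

definition christoffel ::
    "'i::finite metric \<Rightarrow> 'i \<Rightarrow> 'i \<Rightarrow> 'i \<Rightarrow> real ^ 'i \<Rightarrow> real" where
  "christoffel G k i j x =
     (1 / 2) * (\<Sum>l\<in>UNIV. matrix_inv (G x) $ k $ l *
        (partial_deriv i (\<lambda>y. G y $ j $ l) x
         + partial_deriv j (\<lambda>y. G y $ i $ l) x
         - partial_deriv l (\<lambda>y. G y $ i $ j) x))"

text \<open>
  \<open>riemann G l i j k\<close> is \<open>R\<^sup>l\<^sub>i\<^sub>j\<^sub>k\<close>, the \<open>l\<close>-th component of
  \<open>R(\<partial>\<^sub>j, \<partial>\<^sub>k) \<partial>\<^sub>i\<close>.
\<close>

definition riemann ::
    "'i::finite metric \<Rightarrow> 'i \<Rightarrow> 'i \<Rightarrow> 'i \<Rightarrow> 'i \<Rightarrow> real ^ 'i \<Rightarrow> real" where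
  "riemann G l i j k x =
     partial_deriv j (christoffel G l k i) x - partial_deriv k (christoffel G l j i) x
     + (\<Sum>m\<in>UNIV. christoffel G l j m x * christoffel G m k i x
                 - christoffel G l k m x * christoffel G m j i x)"

definition ricci :: "'i::finite metric \<Rightarrow> 'i \<Rightarrow> 'i \<Rightarrow> real ^ 'i \<Rightarrow> real" where
  "ricci G i j x = (\<Sum>l\<in>UNIV. riemann G l i l j x)"

definition ricci_flat_on :: "(real ^ 'i::finite) set \<Rightarrow> 'i metric \<Rightarrow> bool" where
  "ricci_flat_on W G \<longleftrightarrow> (\<forall>x\<in>W. \<forall>i j. ricci G i j x = 0)"


section \<open>Graphs in a flat three-dimensional manifold\<close>

definition graph_metric ::
    "real \<Rightarrow> real ^ 2 ^ 2 \<Rightarrow> (real ^ 2 \<Rightarrow> real) \<Rightarrow> 2 metric" where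
  "graph_metric \<epsilon> g0 \<phi> x =
     (\<chi> \<mu> \<nu>. g0 $ \<mu> $ \<nu> + \<epsilon> * partial_deriv \<mu> \<phi> x * partial_deriv \<nu> \<phi> x)"

definition graph_rho ::
    "real \<Rightarrow> real ^ 2 ^ 2 \<Rightarrow> (real ^ 2 \<Rightarrow> real) \<Rightarrow> real ^ 2 \<Rightarrow> real" where
  "graph_rho \<epsilon> g0 \<phi> x =
     1 + \<epsilon> * (\<Sum>\<mu>\<in>UNIV. \<Sum>\<nu>\<in>UNIV.
               matrix_inv g0 $ \<mu> $ \<nu> * partial_deriv \<mu> \<phi> x * partial_deriv \<nu> \<phi> x)"

definition mean_curvature ::
    "real \<Rightarrow> real ^ 2 ^ 2 \<Rightarrow> (real ^ 2 \<Rightarrow> real) \<Rightarrow> real ^ 2 \<Rightarrow> real" where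
  "mean_curvature \<epsilon> g0 \<phi> x =
     graph_rho \<epsilon> g0 \<phi> x powr (- 1 / 2) *
     (\<Sum>\<mu>\<in>UNIV. \<Sum>\<nu>\<in>UNIV.
        matrix_inv (graph_metric \<epsilon> g0 \<phi> x) $ \<mu> $ \<nu> *
        partial_deriv \<nu> (partial_deriv \<mu> \<phi>) x)"

text \<open>
  The factor \<open>\<rho> powr (- 1 / 2)\<close> is a genuine \<open>\<rho>\<^sup>-\<^sup>1\<^sup>/\<^sup>2\<close> only where
  \<open>\<rho> > 0\<close>; minimality must be used together with that assumption.
\<close>

definition minimal_graph_on ::
    "(real ^ 2) set \<Rightarrow> real \<Rightarrow> real ^ 2 ^ 2 \<Rightarrow> (real ^ 2 \<Rightarrow> real) \<Rightarrow> bool" where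
  "minimal_graph_on U \<epsilon> g0 \<phi> \<longleftrightarrow> (\<forall>x\<in>U. mean_curvature \<epsilon> g0 \<phi> x = 0)"

definition conformal_graph_metric ::
    "real \<Rightarrow> real ^ 2 ^ 2 \<Rightarrow> (real ^ 2 \<Rightarrow> real) \<Rightarrow> 2 metric" where
  "conformal_graph_metric \<epsilon> g0 \<phi> x =
     (\<chi> \<alpha> \<beta>. graph_metric \<epsilon> g0 \<phi> x $ \<alpha> $ \<beta> / sqrt (graph_rho \<epsilon> g0 \<phi> x))"


section \<open>The \<open>(2 + 2n)\<close>-dimensional metric\<close>

text \<open>
  With \<open>n = CARD('n)\<close>, points of \<open>U \<times> \<real>\<^sup>2\<^sup>n\<close> are vectors indexed by
  \<open>2 + 2 \<times> 'n\<close>: the coordinate \<open>Inl \<alpha>\<close> is \<open>x\<^sup>\<alpha>\<close>, the coordinate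
  \<open>Inr (\<alpha>, k)\<close> is \<open>y\<^sub>k\<^sup>\<alpha>\<close>.
\<close>

definition base_point :: "real ^ (2 + 2 \<times> 'n::finite) \<Rightarrow> real ^ 2" where
  "base_point z = (\<chi> \<alpha>. z $ Inl \<alpha>)"

definition cylinder :: "(real ^ 2) set \<Rightarrow> (real ^ (2 + 2 \<times> 'n::finite)) set" where
  "cylinder U = {z. base_point z \<in> U}"

definition total_metric ::
    "2 metric \<Rightarrow> (real ^ 2 \<Rightarrow> real) \<Rightarrow> ('n::finite \<Rightarrow> real) \<Rightarrow> (2 + 2 \<times> 'n) metric" where
  "total_metric g \<Phi> e z =
     (\<chi> i j. case (i, j) of
        (Inl \<alpha>, Inl \<beta>) \<Rightarrow> exp (2 * \<Phi> (base_point z)) * g (base_point z) $ \<alpha> $ \<beta>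
      | (Inr (\<alpha>, k), Inr (\<beta>, l)) \<Rightarrow>
          (if k = l then e k * g (base_point z) $ \<alpha> $ \<beta> else 0)
      | _ \<Rightarrow> 0)"

end

theory Submission
  imports Defs
begin

text \<open>
  The metric \<open>g = h/\<surd>\<rho>\<close> of a minimal graph has constant determinant, and the minimal surface
  equation says that the coordinates \<open>x\<^sup>1, x\<^sup>2\<close> are harmonic for it. Together these mean that
  \<open>\<partial>\<^sub>\<gamma> g\<^sub>\<alpha>\<^sub>\<beta>\<close> is symmetric in all three indices (\<open>codazzi_12\<close>) and trace-free
  (\<open>christoffel_trace\<close>): locally \<open>g\<close> is the Hessian matrix of a solution of a Monge-Ampere equation.
  Such a metric has four properties which carry the proof. With
  \<open>S = 1/4 tr (g\<^sup>-\<^sup>1 \<partial>g g\<^sup>-\<^sup>1 \<partial>g)\<close>, called \<open>christoffel_square\<close> below,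

  \<^item> the matrix \<open>g\<close> solves the sigma model equation \<open>\<partial>\<^sub>a (g\<^sup>a\<^sup>b g\<^sup>-\<^sup>1 \<partial>\<^sub>b g) = 0\<close>
    (\<open>div_christoffel\<close>);
  \<^item> its Ricci tensor is \<open>S\<close>;
  \<^item> \<open>S = \<tau> g\<close> for a function \<open>\<tau>\<close>, since in dimension two the square of a trace-free symmetric
    cubic form is a multiple of the metric (\<open>christoffel_square_isotropic\<close>);
  \<^item> \<open>\<Delta> (ln g\<^sub>1\<^sub>1) = \<Delta> (ln g\<^sub>2\<^sub>2) = 2 \<tau>\<close> (\<open>laplacian_ln_diag\<close>).

  The coefficients of the big metric depend on the base point only. Its mixed Ricci components vanish
  by parity in the fibre coordinates, the fibre components by the sigma model equation, whatever
  \<open>\<Phi>\<close> is. The base components are the Ricci tensor \<open>S - (\<Delta> \<Phi>) g\<close> of \<open>exp (2 \<Phi>) g\<close> minus one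
  copy of \<open>S\<close> for each of the \<open>n\<close> fibres (\<open>ricci_total_base\<close>). Ricci flatness is therefore the
  single scalar equation \<open>\<Delta> \<Phi> = (1 - n) \<tau>\<close>.

  The exponents in the definition of \<open>\<Phi>\<close> are such that
  \<open>\<Phi> = e\<^sub>0 \<phi> - (m\<^sub>1 + n\<^sub>1) ln g\<^sub>1\<^sub>1 - (m\<^sub>2 + n\<^sub>2) ln g\<^sub>2\<^sub>2\<close>. The height \<open>\<phi>\<close> is harmonic on a
  minimal surface, so \<open>\<Delta> \<Phi> = - 2 (m\<^sub>1 + m\<^sub>2 + n\<^sub>1 + n\<^sub>2) \<tau>\<close>, which equals \<open>(1 - n) \<tau>\<close> by the
  conditions on the constants.
\<close>

section \<open>Partial derivatives\<close>

lemma partial_deriv_eqI: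
  assumes "(f has_derivative f') (at x)"
  shows "partial_deriv i f x = f' (axis i 1)"
proof -
  have "((\<lambda>t. x + t *\<^sub>R axis i 1) has_derivative (\<lambda>t. t *\<^sub>R axis i 1)) (at 0)"
    by (auto intro!: derivative_eq_intros)
  moreover have "(f has_derivative f') (at (x + 0 *\<^sub>R axis i 1))"
    using assms by simp
  ultimately have "((\<lambda>t. f (x + t *\<^sub>R axis i 1)) has_derivative (\<lambda>t. f' (t *\<^sub>R axis i 1))) (at 0)"
    by (rule has_derivative_compose)
  moreover have "f' (t *\<^sub>R axis i 1) = f' (axis i 1) * t" for t
    using linear_scale[OF has_derivative_linear[OF assms]] by simp
  ultimately have "((\<lambda>t. f (x + t *\<^sub>R axis i 1)) has_real_derivative f' (axis i 1)) (at 0)"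
    by (simp add: has_field_derivative_def)
  then show ?thesis
    unfolding partial_deriv_def by (rule DERIV_imp_deriv)
qed

lemma frechet_axis:
  "f differentiable (at x) \<Longrightarrow> frechet_derivative f (at x) (axis i 1) = partial_deriv i f x"
  by (metis partial_deriv_eqI frechet_derivative_works)

lemma DERIV_along_axis:
  assumes "f differentiable (at (x + t *\<^sub>R axis i 1))"
  shows "((\<lambda>t. f (x + t *\<^sub>R axis i 1)) has_real_derivative
           partial_deriv i f (x + t *\<^sub>R axis i 1)) (at t)"
proof -
  let ?y = "x + t *\<^sub>R axis i 1" and ?F = "frechet_derivative f (at (x + t *\<^sub>R axis i 1))"
  have D: "(f has_derivative ?F) (at ?y)"
    using assms frechet_derivative_works by blast
  have "((\<lambda>t. x + t *\<^sub>R axis i 1) has_derivative (\<lambda>t. t *\<^sub>R axis i 1)) (at t)"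
    by (auto intro!: derivative_eq_intros)
  from has_derivative_compose[OF this D]
  have "((\<lambda>t. f (x + t *\<^sub>R axis i 1)) has_derivative (\<lambda>s. ?F (s *\<^sub>R axis i 1))) (at t)" .
  moreover have "?F (s *\<^sub>R axis i 1) = partial_deriv i f ?y * s" for s
    using linear_scale[OF has_derivative_linear[OF D]] frechet_axis[OF assms] by simp
  ultimately show ?thesis by (simp add: has_field_derivative_def)
qed

lemma partial_deriv_const [simp]: "partial_deriv i (\<lambda>y. c) x = 0"
  by (simp add: partial_deriv_def)

lemma partial_deriv_add [simp]:
  assumes "f differentiable (at x)" "g differentiable (at x)"
  shows "partial_deriv i (\<lambda>y. f y + g y) x = partial_deriv i f x + partial_deriv i g x"
  using partial_deriv_eqI[OF has_derivative_add[OF assms[unfolded frechet_derivative_works]]]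
  by (simp add: frechet_axis assms)

lemma partial_deriv_minus [simp]:
  assumes "f differentiable (at x)"
  shows "partial_deriv i (\<lambda>y. - f y) x = - partial_deriv i f x"
  using partial_deriv_eqI[OF has_derivative_minus[OF assms[unfolded frechet_derivative_works]]]
  by (simp add: frechet_axis assms)

lemma partial_deriv_diff [simp]:
  assumes "f differentiable (at x)" "g differentiable (at x)"
  shows "partial_deriv i (\<lambda>y. f y - g y) x = partial_deriv i f x - partial_deriv i g x"
  using partial_deriv_eqI[OF has_derivative_diff[OF assms[unfolded frechet_derivative_works]]]
  by (simp add: frechet_axis assms)

lemma partial_deriv_mult [simp]:
  assumes "f differentiable (at x)" "g differentiable (at x)"
  shows "partial_deriv i (\<lambda>y. f y * g y) x = f x * partial_deriv i g x + partial_deriv i f x * g x"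
  using partial_deriv_eqI[OF has_derivative_mult[OF assms[unfolded frechet_derivative_works]]]
  by (simp add: frechet_axis assms)

lemma
  assumes h: "(h has_real_derivative h') (at (f x))" and f: "f differentiable (at x)"
  shows partial_deriv_chain: "partial_deriv i (\<lambda>y. h (f y)) x = h' * partial_deriv i f x"
    and differentiable_chain: "(\<lambda>y. h (f y)) differentiable (at x)"
proof -
  have "((\<lambda>y. h (f y)) has_derivative (\<lambda>v. h' * frechet_derivative f (at x) v)) (at x)"
    by (rule has_derivative_compose[OF f[unfolded frechet_derivative_works] 
          h[unfolded has_field_derivative_def]])
  from partial_deriv_eqI[OF this] differentiableI[OF this]
  show "partial_deriv i (\<lambda>y. h (f y)) x = h' * partial_deriv i f x"
    "(\<lambda>y. h (f y)) differentiable (at x)"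
    by (simp_all add: frechet_axis f)
qed

lemma
  assumes "f differentiable (at x)"
  shows partial_deriv_exp [simp]: "partial_deriv i (\<lambda>y. exp (f y)) x = exp (f x) * partial_deriv i f x"
    and differentiable_exp [simp]: "(\<lambda>y. exp (f y) :: real) differentiable (at x)"
  using partial_deriv_chain[OF DERIV_exp assms] differentiable_chain[OF DERIV_exp assms] by auto

lemma
  assumes "f differentiable (at x)" "f x > 0"
  shows partial_deriv_ln [simp]: "partial_deriv i (\<lambda>y. ln (f y)) x = partial_deriv i f x / f x"
    and differentiable_ln [simp]: "(\<lambda>y. ln (f y) :: real) differentiable (at x)"
  using partial_deriv_chain[OF DERIV_ln assms(1)] differentiable_chain[OF DERIV_ln assms(1)] assms(2)
  by (auto simp: field_simps)

lemma
  assumes "f differentiable (at x)" "f x \<noteq> (0::real)"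
  shows partial_deriv_inverse [simp]:
    "partial_deriv i (\<lambda>y. inverse (f y)) x = - (inverse (f x) * inverse (f x) * partial_deriv i f x)"
  using partial_deriv_chain[OF DERIV_inverse[OF assms(2)] assms(1)] 
  by (auto simp: power2_eq_square)

lemma partial_deriv_cdivide [simp]:
  assumes "f differentiable (at x)"
  shows "partial_deriv i (\<lambda>y. f y / c) x = partial_deriv i f x / c"
  using partial_deriv_mult[OF assms differentiable_const, of i "inverse c"]
  by (simp add: divide_inverse)

lemma partial_deriv_divide:
  assumes "f differentiable (at x)" "g differentiable (at x)" "g x \<noteq> 0"
  shows "partial_deriv i (\<lambda>y. f y / g y) x
    = (partial_deriv i f x * g x - f x * partial_deriv i g x) / (g x * g x)"
  using assms by (simp add: divide_inverse algebra_simps)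

text \<open>
  Only the germ of a function matters. Since all the identities between metric coefficients hold
  just on \<open>U\<close>, every differentiation of such an identity goes through this lemma.
\<close>

lemma partial_deriv_cong:
  assumes "open U" "x \<in> U" "\<And>y. y \<in> U \<Longrightarrow> f y = g y"
  shows "partial_deriv i f x = partial_deriv i g x"
  unfolding partial_deriv_def
proof (rule deriv_cong_ev)
  have "open ((\<lambda>t. x + t *\<^sub>R axis i 1) -` U)"
    by (rule open_vimage[OF assms(1)]) (intro continuous_intros)
  moreover have "0 \<in> (\<lambda>t::real. x + t *\<^sub>R axis i 1) -` U"
    using assms(2) by simp
  ultimately have "\<forall>\<^sub>F t in nhds 0. t \<in> (\<lambda>t::real. x + t *\<^sub>R axis i 1) -` U"
    by (rule eventually_nhds_in_open)
  then show "\<forall>\<^sub>F t in nhds 0. f (x + t *\<^sub>R axis i 1) = g (x + t *\<^sub>R axis i 1)"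
    by eventually_elim (use assms(3) in auto)
qed simp

lemma differentiable_cong_open:
  assumes "open U" "x \<in> U" "\<And>y. y \<in> U \<Longrightarrow> f y = g y" "g differentiable (at x)"
  shows "f differentiable (at x)"
  by (metis assms differentiable_def has_derivative_transform_within_open)

section \<open>Smooth functions\<close>

lemma Ck_on_cong:
  assumes "open U" "\<And>y. y \<in> U \<Longrightarrow> f y = g y" "Ck_on k U g"
  shows "Ck_on k U f"
  using assms(2,3)
proof (induction k arbitrary: f g)
  case 0
  then show ?case by (simp cong: continuous_on_cong)
next
  case (Suc k)
  show ?case unfolding Ck_on.simps
  proof (intro conjI ballI allI)
    fix x assume "x \<in> U"
    then show "f differentiable (at x)"
      using differentiable_cong_open[OF assms(1) _ Suc.prems(1)] Suc.prems(2) by auto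
  next
    fix i
    show "Ck_on k U (partial_deriv i f)"
      using Suc.IH[of "partial_deriv i f" "partial_deriv i g"] partial_deriv_cong[OF assms(1) _ Suc.prems(1)] Suc.prems(2) by auto
  qed
qed

lemma Ck_on_continuous: "Ck_on k U f \<Longrightarrow> continuous_on U f"
  by (cases k) (auto intro!: continuous_at_imp_continuous_on differentiable_imp_continuous_within)

lemma Ck_on_pred: "Ck_on (Suc k) U f \<Longrightarrow> Ck_on k U f"
proof (induction k arbitrary: f)
  case 0
  then show ?case using Ck_on_continuous by (metis Ck_on.simps(1))
next
  case (Suc k)
  then show ?case by (metis Ck_on.simps(2))
qed

lemma Ck_on_const: "Ck_on k U (\<lambda>x. c)"
proof (induction k arbitrary: c)
  case (Suc k)
  have "partial_deriv i (\<lambda>x. c) = (\<lambda>x. 0)" for i :: 'a by auto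
  with Suc show ?case by auto
qed auto

lemma Ck_on_add:
  assumes "open U"
  shows "Ck_on k U f \<Longrightarrow> Ck_on k U g \<Longrightarrow> Ck_on k U (\<lambda>x. f x + g x)"
proof (induction k arbitrary: f g)
  case 0
  then show ?case
    using assms unfolding Ck_on.simps by (intro continuous_on_add) auto
next
  case (Suc k)
  have "Ck_on k U (partial_deriv i (\<lambda>x. f x + g x))" for i
    by (rule Ck_on_cong[OF assms _ Suc.IH[of "partial_deriv i f" "partial_deriv i g"]])
       (use Suc.prems in auto)
  with Suc.prems show ?case by auto
qed

lemma Ck_on_mult:
  assumes "open U"
  shows "Ck_on k U f \<Longrightarrow> Ck_on k U g \<Longrightarrow> Ck_on k U (\<lambda>x. f x * g x)"
proof (induction k arbitrary: f g)
  case 0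
  then show ?case
    using assms unfolding Ck_on.simps by (intro continuous_on_mult) auto
next
  case (Suc k)
  have "Ck_on k U (partial_deriv i (\<lambda>x. f x * g x))" for i
  proof (rule Ck_on_cong[OF assms])
    show "Ck_on k U (\<lambda>x. f x * partial_deriv i g x + partial_deriv i f x * g x)"
      by (intro Ck_on_add[OF assms] Suc.IH)
         (use Suc.prems Suc.prems[THEN Ck_on_pred] in auto)
  qed (use Suc.prems in auto)
  with Suc.prems show ?case by auto
qed

text \<open>
  The derivative of \<open>1/f\<close> is a product involving \<open>1/f\<close> itself, one order of
  differentiability lower; so induction on \<open>k\<close> and closure under products suffice. The same holds
  for \<open>exp f\<close>, while the derivative of \<open>ln f\<close> reduces to the reciprocal.
\<close>

lemma Ck_on_inverse:
  assumes "open U" and nz: "\<And>x. x \<in> U \<Longrightarrow> f x \<noteq> 0"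
  shows "Ck_on k U f \<Longrightarrow> Ck_on k U (\<lambda>x. inverse (f x))"
proof (induction k)
  case 0
  then show ?case
    using assms unfolding Ck_on.simps by (intro continuous_on_inverse) auto
next
  case (Suc k)
  have "Ck_on k U (partial_deriv i (\<lambda>x. inverse (f x)))" for i
  proof (rule Ck_on_cong[OF assms(1)])
    show "Ck_on k U (\<lambda>x. (- 1) * (inverse (f x) * inverse (f x) * partial_deriv i f x))"
      by (intro Ck_on_mult[OF assms(1)] Ck_on_const Suc.IH)
         (use Suc.prems Ck_on_pred[OF Suc.prems] in auto)
  qed (use Suc.prems nz in auto)
  with Suc.prems nz show ?case by auto
qed

lemma Ck_on_exp:
  assumes "open U"
  shows "Ck_on k U f \<Longrightarrow> Ck_on k U (\<lambda>x. exp (f x))"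
proof (induction k)
  case 0
  then show ?case
    using assms unfolding Ck_on.simps by (intro continuous_on_exp) auto
next
  case (Suc k)
  have "Ck_on k U (partial_deriv i (\<lambda>x. exp (f x)))" for i
  proof (rule Ck_on_cong[OF assms(1)])
    show "Ck_on k U (\<lambda>x. exp (f x) * partial_deriv i f x)"
      by (intro Ck_on_mult[OF assms(1)] Suc.IH)
         (use Suc.prems Ck_on_pred[OF Suc.prems] in auto)
  qed (use Suc.prems in auto)
  with Suc.prems show ?case by auto
qed

lemma Ck_on_ln:
  assumes "open U" and pos: "\<And>x. x \<in> U \<Longrightarrow> f x > 0"
  shows "Ck_on k U f \<Longrightarrow> Ck_on k U (\<lambda>x. ln (f x))"
proof (cases k)
  case 0
  have "f x \<noteq> 0" if "x \<in> U" for x using pos[OF that] by simp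
  then show "Ck_on k U f \<Longrightarrow> Ck_on k U (\<lambda>x. ln (f x))"
    unfolding 0 Ck_on.simps by (intro continuous_on_ln) auto
next
  case (Suc k')
  assume "Ck_on k U f"
  then have f: "Ck_on (Suc k') U f" using Suc by simp
  have "f x \<noteq> 0" if "x \<in> U" for x using pos[OF that] by simp
  have "Ck_on k' U (partial_deriv i (\<lambda>x. ln (f x)))" for i
  proof (rule Ck_on_cong[OF assms(1)])
    show "Ck_on k' U (\<lambda>x. partial_deriv i f x * inverse (f x))"
      by (intro Ck_on_mult Ck_on_inverse assms(1))
         (use f Ck_on_pred[OF f] \<open>\<And>x. x \<in> U \<Longrightarrow> f x \<noteq> 0\<close> in auto)
  qed (use f pos in \<open>auto simp: field_simps\<close>)
  with f pos Suc show ?thesis by auto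
qed

lemma smooth_on_cong:
  "open U \<Longrightarrow> smooth_on U g \<Longrightarrow> (\<And>y. y \<in> U \<Longrightarrow> f y = g y) \<Longrightarrow> smooth_on U f"
  unfolding smooth_on_def using Ck_on_cong by blast

lemma smooth_on_const [simp]: "smooth_on U (\<lambda>x. c)"
  by (simp add: smooth_on_def Ck_on_const)

lemma smooth_on_add:
  "open U \<Longrightarrow> smooth_on U f \<Longrightarrow> smooth_on U g \<Longrightarrow> smooth_on U (\<lambda>x. f x + g x)"
  by (simp add: smooth_on_def Ck_on_add)

lemma smooth_on_mult:
  "open U \<Longrightarrow> smooth_on U f \<Longrightarrow> smooth_on U g \<Longrightarrow> smooth_on U (\<lambda>x. f x * g x)"
  by (simp add: smooth_on_def Ck_on_mult)

lemma smooth_on_diff: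
  assumes "open U" "smooth_on U f" "smooth_on U g"
  shows "smooth_on U (\<lambda>x. f x - g x)"
  using smooth_on_add[OF assms(1,2) smooth_on_mult[OF assms(1) smooth_on_const[where c = "-1"] assms(3)]] by simp

lemma smooth_on_exp: "open U \<Longrightarrow> smooth_on U f \<Longrightarrow> smooth_on U (\<lambda>x. exp (f x))"
  by (simp add: smooth_on_def Ck_on_exp)

lemma smooth_on_ln:
  "open U \<Longrightarrow> smooth_on U f \<Longrightarrow> (\<And>x. x \<in> U \<Longrightarrow> f x > 0) \<Longrightarrow> smooth_on U (\<lambda>x. ln (f x))"
  by (simp add: smooth_on_def Ck_on_ln)

lemma smooth_on_partial_deriv: "smooth_on U f \<Longrightarrow> smooth_on U (partial_deriv i f)"
  unfolding smooth_on_def using Ck_on.simps(2) by blast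

lemma smooth_on_differentiable: "smooth_on U f \<Longrightarrow> x \<in> U \<Longrightarrow> f differentiable (at x)"
  unfolding smooth_on_def using Ck_on.simps(2) by blast

lemma smooth_on_continuous_on: "smooth_on U f \<Longrightarrow> continuous_on U f"
  unfolding smooth_on_def using Ck_on_continuous by blast

section \<open>Symmetry of second partial derivatives\<close>

text \<open>
  The second difference over a square with sides along the axes \<open>i\<close> and \<open>j\<close> is a value of the
  mixed derivative, by the mean value theorem applied first in direction \<open>i\<close> and then in direction
  \<open>j\<close>. The difference is symmetric in \<open>i\<close> and \<open>j\<close>, so the two mixed derivatives take
  equal values at points arbitrarily near to \<open>x\<close>, and by continuity agree at \<open>x\<close>.
\<close>

lemma second_difference:
  fixes f :: "real ^ 'i::finite \<Rightarrow> real"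
  assumes f: "smooth_on U f" and t: "0 < t" "cball x (2 * t) \<subseteq> U"
  shows "\<exists>y \<in> cball x (2 * t).
    f (x + t *\<^sub>R axis i 1 + t *\<^sub>R axis j 1) - f (x + t *\<^sub>R axis i 1) - f (x + t *\<^sub>R axis j 1) + f x
      = t * t * partial_deriv j (partial_deriv i f) y"
proof -
  have near: "x + a *\<^sub>R axis i 1 + b *\<^sub>R axis j 1 \<in> cball x (2 * t)"
    if "0 \<le> a" "a \<le> t" "0 \<le> b" "b \<le> t" for a b
  proof -
    have "norm (a *\<^sub>R axis i 1 + b *\<^sub>R axis j 1 :: real ^ 'i) \<le> \<bar>a\<bar> + \<bar>b\<bar>"
      by (rule order_trans[OF norm_triangle_ineq]) simp
    then show ?thesis using that by (simp add: dist_norm norm_minus_commute algebra_simps)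
  qed
  have inU: "x + a *\<^sub>R axis i 1 + b *\<^sub>R axis j 1 \<in> U"
    if "0 \<le> a" "a \<le> t" "0 \<le> b" "b \<le> t" for a b
    using near[OF that] t(2) by blast
  note df = smooth_on_differentiable[OF f] and dfi = smooth_on_differentiable[OF smooth_on_partial_deriv[OF f]]
  \<comment> \<open>The increment in direction \<open>j\<close>, seen as a function of the position along \<open>i\<close>.\<close>
  define F where "F = (\<lambda>a. f ((x + t *\<^sub>R axis j 1) + a *\<^sub>R axis i 1) - f (x + a *\<^sub>R axis i 1))"
  define F' where "F' = (\<lambda>a. partial_deriv i f ((x + t *\<^sub>R axis j 1) + a *\<^sub>R axis i 1)
    - partial_deriv i f (x + a *\<^sub>R axis i 1))"
  have "(F has_real_derivative F' a) (at a)" if "0 \<le> a" "a \<le> t" for a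
    unfolding F_def F'_def
    using inU[OF that, of 0] inU[OF that, of t] t(1)
    by (intro DERIV_diff DERIV_along_axis df) (auto simp: add.assoc add.commute add.left_commute)
  with MVT2[OF t(1)] obtain a where a: "0 < a" "a < t" "F t - F 0 = (t - 0) * F' a"
    by blast
  define G where "G = (\<lambda>b. partial_deriv i f ((x + a *\<^sub>R axis i 1) + b *\<^sub>R axis j 1))"
  define G' where "G' = (\<lambda>b. partial_deriv j (partial_deriv i f) ((x + a *\<^sub>R axis i 1) + b *\<^sub>R axis j 1))"
  have "(G has_real_derivative G' b) (at b)" if "0 \<le> b" "b \<le> t" for b
    unfolding G_def G'_def
    using inU[of a b] that a by (intro DERIV_along_axis dfi) auto
  with MVT2[OF t(1)] obtain b where b: "0 < b" "b < t" "G t - G 0 = (t - 0) * G' b"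
    by blast
  have "F' a = G t - G 0"
    by (simp add: F'_def G_def add.commute add.left_commute)
  then have "F t - F 0 = t * t * G' b"
    using a(3) b(3) by simp
  moreover have "F t - F 0 = f (x + t *\<^sub>R axis i 1 + t *\<^sub>R axis j 1)
      - f (x + t *\<^sub>R axis i 1) - f (x + t *\<^sub>R axis j 1) + f x"
    by (simp add: F_def add.commute add.left_commute)
  ultimately show ?thesis
    using near[of a b] a b unfolding G'_def by auto
qed

lemma partial_deriv_commute:
  fixes f :: "real ^ 'i::finite \<Rightarrow> real"
  assumes "open U" "smooth_on U f" "x \<in> U"
  shows "partial_deriv i (partial_deriv j f) x = partial_deriv j (partial_deriv i f) x"
proof (rule ccontr)
  let ?A = "partial_deriv i (partial_deriv j f)" and ?B = "partial_deriv j (partial_deriv i f)"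
  assume ne: "?A x \<noteq> ?B x"
  define e where "e = \<bar>?A x - ?B x\<bar> / 2"
  have "e > 0" using ne by (simp add: e_def)
  have "continuous_on U ?A" "continuous_on U ?B"
    by (auto intro!: smooth_on_continuous_on smooth_on_partial_deriv assms(2))
  then have "isCont ?A x" "isCont ?B x"
    using assms(1,3) by (auto simp: continuous_on_eq_continuous_at)
  then obtain d1 d2 where d: "d1 > 0" "d2 > 0"
    "\<forall>y. dist y x < d1 \<longrightarrow> dist (?A y) (?A x) < e"
    "\<forall>y. dist y x < d2 \<longrightarrow> dist (?B y) (?B x) < e"
    using \<open>e > 0\<close> unfolding continuous_at_eps_delta dist_real_def[symmetric] dist_norm
    by blast
  obtain d3 where d3: "d3 > 0" "cball x d3 \<subseteq> U"
    using assms(1,3) open_contains_cball by blast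
  define t where "t = min d3 (min d1 d2) / 4"
  have t: "t > 0" "2 * t < d1" "2 * t < d2" "2 * t \<le> d3"
    using d d3 by (auto simp: t_def)
  then have sub: "cball x (2 * t) \<subseteq> U" using d3(2) by force
  obtain y where y: "y \<in> cball x (2 * t)"
    "f (x + t *\<^sub>R axis j 1 + t *\<^sub>R axis i 1) - f (x + t *\<^sub>R axis j 1) - f (x + t *\<^sub>R axis i 1) + f x
      = t * t * ?A y"
    using second_difference[OF assms(2) t(1) sub] by blast
  obtain z where z: "z \<in> cball x (2 * t)"
    "f (x + t *\<^sub>R axis i 1 + t *\<^sub>R axis j 1) - f (x + t *\<^sub>R axis i 1) - f (x + t *\<^sub>R axis j 1) + f x
      = t * t * ?B z"
    using second_difference[OF assms(2) t(1) sub] by blast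
  have "x + t *\<^sub>R axis j 1 + t *\<^sub>R axis i 1 = x + t *\<^sub>R axis i 1 + t *\<^sub>R axis j (1::real)"
    by (simp add: ac_simps)
  with y(2) z(2) have "t * t * ?A y = t * t * ?B z" by (simp only:)
  then have "?A y = ?B z" using t(1) by simp
  have 1: "dist (?A x) (?A y) < e"
    using d(3)[rule_format, of y] y(1) t by (simp add: dist_commute)
  have 2: "dist (?B x) (?A y) < e"
    unfolding \<open>?A y = ?B z\<close> using d(4)[rule_format, of z] z(1) t by (simp add: dist_commute)
  from dist_triangle_less_add[OF 1 2] show False
    by (simp add: e_def dist_real_def)
qed

section \<open>Inverse matrices\<close>

lemma matrix_inv_eqI:
  fixes A :: "real ^ 'n ^ 'n"
  assumes "A ** B = mat 1"
  shows "matrix_inv A = B"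
proof -
  have *: "A ** B = mat 1 \<and> B ** A = mat 1"
    using assms matrix_left_right_inverse by blast
  then have "A ** matrix_inv A = mat 1 \<and> matrix_inv A ** A = mat 1"
    unfolding matrix_inv_def by (rule someI)
  then show ?thesis
    using * by (metis matrix_mul_assoc matrix_mul_lid matrix_mul_rid)
qed

lemma matrix_inv_2:
  fixes A :: "real ^ 2 ^ 2"
  assumes "d = A $ 1 $ 1 * A $ 2 $ 2 - A $ 1 $ 2 * A $ 2 $ 1" "d \<noteq> 0"
  shows "matrix_inv A $ 1 $ 1 = A $ 2 $ 2 / d" "matrix_inv A $ 1 $ 2 = - A $ 1 $ 2 / d"
    "matrix_inv A $ 2 $ 1 = - A $ 2 $ 1 / d" "matrix_inv A $ 2 $ 2 = A $ 1 $ 1 / d"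
proof -
  define B :: "real ^ 2 ^ 2" where
    "B = vector [vector [A $ 2 $ 2 / d, - A $ 1 $ 2 / d], vector [- A $ 2 $ 1 / d, A $ 1 $ 1 / d]]"
  have B: "B $ 1 $ 1 = A $ 2 $ 2 / d" "B $ 1 $ 2 = - A $ 1 $ 2 / d"
    "B $ 2 $ 1 = - A $ 2 $ 1 / d" "B $ 2 $ 2 = A $ 1 $ 1 / d"
    by (simp_all add: B_def)
  have "A ** B = mat 1"
    using assms(2)
    by (simp add: vec_eq_iff forall_2 matrix_matrix_mult_def sum_2 mat_def B field_simps)
       (simp add: assms(1) field_simps)
  then have "matrix_inv A = B"
    by (rule matrix_inv_eqI)
  with B show "matrix_inv A $ 1 $ 1 = A $ 2 $ 2 / d" "matrix_inv A $ 1 $ 2 = - A $ 1 $ 2 / d"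
    "matrix_inv A $ 2 $ 1 = - A $ 2 $ 1 / d" "matrix_inv A $ 2 $ 2 = A $ 1 $ 1 / d"
    by simp_all
qed

section \<open>Two-dimensional Hessian metrics of constant determinant\<close>

text \<open>
  Write \<open>g\<close> for the symmetric matrix with rows \<open>(E, F)\<close> and \<open>(F, G)\<close>, and let \<open>m\<close>,
  \<open>n\<close> be traceless matrices for which \<open>g m\<close>, \<open>g n\<close> are symmetric. The left side is
  \<open>det g * tr (m n)\<close>; for traceless \<open>2 \<times> 2\<close> matrices the trace of a product is minus the
  polarised determinant, and \<open>det (g m) = det g * det m\<close> turns it into the entries of \<open>g m\<close> and
  \<open>g n\<close> on the right.
\<close>

lemma trace_product_traceless:
  fixes E F G :: real
  assumes "D = E * G - F * F"
    and "E * m12 - F * m11 = F * m11 + G * m21" "E * n12 - F * n11 = F * n11 + G * n21"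
  shows "D * (2 * m11 * n11 + m12 * n21 + m21 * n12)
    = 2 * (F * m11 + G * m21) * (F * n11 + G * n21)
      - (F * m12 - G * m11) * (E * n11 + F * n21) - (E * m11 + F * m21) * (F * n12 - G * n11)"
  using assms by algebra

text \<open>
  The numbers \<open>a, b, c, d\<close> are the components \<open>111, 112, 122, 222\<close> of a symmetric cubic
  form whose trace with respect to \<open>g\<close> vanishes. Both \<open>(a, b, c)\<close> and \<open>(b, c, d)\<close> are
  orthogonal to \<open>(G, - 2 F, E)\<close>, hence their cross product is a multiple of this vector: the Hessian
  of a trace-free binary cubic is a multiple of the quadratic form.
\<close>

lemma apolar_cubic:
  fixes E F G :: real
  assumes "G * a - 2 * F * b + E * c = 0" "G * b - 2 * F * c + E * d = 0"
  shows "E * (b * c - a * d) = 2 * F * (b * b - a * c)"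
    "E * (c * c - b * d) = G * (b * b - a * c)"
  using assms by algebra+

text \<open>
  By the Codazzi condition \<open>codazzi\<close> the metric is locally the Hessian matrix of a function, which
  then solves a Monge-Ampere equation because the determinant is constant. Equivalently, the
  coordinates are harmonic. The first derivatives of \<open>g\<close> thus form a totally symmetric tensor,
  and constancy of the determinant makes this tensor trace-free; everything below follows from these
  two facts.
\<close>

locale hessian_metric =
  fixes U :: "(real ^ 2) set" and g :: "2 metric" and D :: real
  assumes open_U: "open U"
    and smooth_g: "smooth_on U (\<lambda>x. g x $ \<alpha> $ \<beta>)"
    and sym_g: "x \<in> U \<Longrightarrow> g x $ \<alpha> $ \<beta> = g x $ \<beta> $ \<alpha>"
    and det_g: "x \<in> U \<Longrightarrow> g x $ 1 $ 1 * g x $ 2 $ 2 - g x $ 1 $ 2 * g x $ 1 $ 2 = D"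
    and D_nz: "D \<noteq> 0"
    and codazzi: "x \<in> U \<Longrightarrow>
      partial_deriv \<gamma> (\<lambda>y. g y $ \<alpha> $ \<beta>) x = partial_deriv \<alpha> (\<lambda>y. g y $ \<gamma> $ \<beta>) x"
begin

abbreviation "E \<equiv> \<lambda>x. g x $ 1 $ 1"
abbreviation "F \<equiv> \<lambda>x. g x $ 1 $ 2"
abbreviation "G \<equiv> \<lambda>x. g x $ 2 $ 2"

lemma g21: "x \<in> U \<Longrightarrow> g x $ 2 $ 1 = F x"
  by (rule sym_g)

lemma partial_deriv_g21: "x \<in> U \<Longrightarrow> partial_deriv \<gamma> (\<lambda>y. g y $ 2 $ 1) x = partial_deriv \<gamma> F x"
  by (rule partial_deriv_cong[OF open_U]) (auto intro: sym_g)

lemma partial_deriv_g_sym: "x \<in> U \<Longrightarrow> partial_deriv \<gamma> (\<lambda>y. g y $ \<alpha> $ \<beta>) x = partial_deriv \<gamma> (\<lambda>y. g y $ \<beta> $ \<alpha>) x"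
  by (rule partial_deriv_cong[OF open_U]) (auto intro: sym_g)

lemma first_derivs:
  assumes "x \<in> U"
  shows "partial_deriv 1 F x = partial_deriv 2 E x" "partial_deriv 1 G x = partial_deriv 2 F x"
  using codazzi[OF assms, of 2 1 1] codazzi[OF assms, of 2 1 2] partial_deriv_g21[OF assms] by auto

lemma inverse_g:
  assumes "x \<in> U"
  shows "matrix_inv (g x) $ 1 $ 1 = G x / D" "matrix_inv (g x) $ 1 $ 2 = - F x / D"
    "matrix_inv (g x) $ 2 $ 1 = - F x / D" "matrix_inv (g x) $ 2 $ 2 = E x / D"
  using matrix_inv_2[of D "g x"] assms by (simp_all add: g21 det_g D_nz)

lemma smooth_partial_deriv_g: "smooth_on U (partial_deriv \<gamma> (\<lambda>x. g x $ \<alpha> $ \<beta>))"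
  by (intro smooth_on_partial_deriv smooth_g)

lemmas differentiable_g [simp] = smooth_on_differentiable[OF smooth_g]
lemmas differentiable_partial_deriv_g [simp] = smooth_on_differentiable[OF smooth_partial_deriv_g]

text \<open>
  The trace of \<open>g\<^sup>-\<^sup>1 \<partial>\<^sub>\<gamma> g\<close> vanishes.
\<close>

lemma det_deriv:
  assumes "x \<in> U"
  shows "G x * partial_deriv \<gamma> E x - 2 * F x * partial_deriv \<gamma> F x + E x * partial_deriv \<gamma> G x = 0"
proof -
  have "partial_deriv \<gamma> (\<lambda>x. E x * G x - F x * F x) x = partial_deriv \<gamma> (\<lambda>x. D) x"
    by (rule partial_deriv_cong[OF open_U assms]) (rule det_g)
  then show ?thesis using assms by (simp add: algebra_simps)
qed

lemma det_deriv2: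
  assumes "x \<in> U"
  shows "G x * partial_deriv \<delta> (partial_deriv \<gamma> E) x - 2 * F x * partial_deriv \<delta> (partial_deriv \<gamma> F) x
    + E x * partial_deriv \<delta> (partial_deriv \<gamma> G) x
    = 2 * partial_deriv \<delta> F x * partial_deriv \<gamma> F x
      - partial_deriv \<delta> G x * partial_deriv \<gamma> E x - partial_deriv \<delta> E x * partial_deriv \<gamma> G x"
proof -
  have "partial_deriv \<delta> (\<lambda>x. G x * partial_deriv \<gamma> E x - 2 * F x * partial_deriv \<gamma> F x + E x * partial_deriv \<gamma> G x) x
     = partial_deriv \<delta> (\<lambda>x. 0) x"
    by (rule partial_deriv_cong[OF open_U assms]) (rule det_deriv)
  then show ?thesis using assms by (simp add: algebra_simps)
qed

text \<open>
  The second derivatives of \<open>g\<close> are fourth derivatives of the local potential, so their four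
  indices may be permuted.
\<close>

lemma second_derivs:
  assumes "x \<in> U"
  shows "partial_deriv \<gamma> (partial_deriv \<delta> (\<lambda>y. g y $ \<alpha> $ \<beta>)) x
       = partial_deriv \<alpha> (partial_deriv \<beta> (\<lambda>y. g y $ \<gamma> $ \<delta>)) x"
proof -
  have "partial_deriv \<gamma> (partial_deriv \<delta> (\<lambda>y. g y $ \<alpha> $ \<beta>)) x
      = partial_deriv \<gamma> (partial_deriv \<alpha> (\<lambda>y. g y $ \<delta> $ \<beta>)) x"
    by (rule partial_deriv_cong[OF open_U assms]) (rule codazzi)
  also have "\<dots> = partial_deriv \<alpha> (partial_deriv \<gamma> (\<lambda>y. g y $ \<delta> $ \<beta>)) x"
    by (rule partial_deriv_commute[OF open_U smooth_g assms])
  also have "\<dots> = partial_deriv \<alpha> (partial_deriv \<beta> (\<lambda>y. g y $ \<gamma> $ \<delta>)) x"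
  proof (rule partial_deriv_cong[OF open_U assms])
    fix y assume "y \<in> U"
    then show "partial_deriv \<gamma> (\<lambda>y. g y $ \<delta> $ \<beta>) y = partial_deriv \<beta> (\<lambda>y. g y $ \<gamma> $ \<delta>) y"
      using codazzi[of y \<gamma> \<beta> \<delta>] partial_deriv_g_sym[of y \<gamma> \<delta> \<beta>] by simp
  qed
  finally show ?thesis .
qed

text \<open>
  Total symmetry makes the three terms of the Christoffel symbol equal up to sign, so that
  \<open>\<Gamma>\<close> is just half of the derivative of \<open>g\<close> with an index raised.
\<close>

lemma christoffel_g:
  assumes "x \<in> U"
  shows "christoffel g \<gamma> \<alpha> \<beta> x =
    (\<Sum>\<delta>\<in>UNIV. matrix_inv (g x) $ \<gamma> $ \<delta> * partial_deriv \<delta> (\<lambda>y. g y $ \<alpha> $ \<beta>) x) / 2"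
proof -
  have "partial_deriv \<alpha> (\<lambda>y. g y $ \<beta> $ \<delta>) x + partial_deriv \<beta> (\<lambda>y. g y $ \<alpha> $ \<delta>) x
      - partial_deriv \<delta> (\<lambda>y. g y $ \<alpha> $ \<beta>) x = partial_deriv \<delta> (\<lambda>y. g y $ \<alpha> $ \<beta>) x" for \<delta>
    using codazzi[OF assms, of \<alpha> \<beta> \<delta>] codazzi[OF assms, of \<beta> \<delta> \<alpha>]
      partial_deriv_g_sym[OF assms, of \<beta> \<alpha> \<delta>] partial_deriv_g_sym[OF assms, of \<delta> \<alpha> \<beta>] by simp
  then show ?thesis unfolding christoffel_def by simp
qed

lemma christoffel_explicit:
  assumes "x \<in> U"
  shows
   "christoffel g 1 \<alpha> \<beta> x = (G x * partial_deriv 1 (\<lambda>y. g y $ \<alpha> $ \<beta>) x - F x * partial_deriv 2 (\<lambda>y. g y $ \<alpha> $ \<beta>) x) / (2 * D)"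
   "christoffel g 2 \<alpha> \<beta> x = (E x * partial_deriv 2 (\<lambda>y. g y $ \<alpha> $ \<beta>) x - F x * partial_deriv 1 (\<lambda>y. g y $ \<alpha> $ \<beta>) x) / (2 * D)"
  using assms D_nz by (simp_all add: christoffel_g sum_2 inverse_g field_simps)

lemma christoffel_sym: "x \<in> U \<Longrightarrow> christoffel g \<gamma> \<alpha> \<beta> x = christoffel g \<gamma> \<beta> \<alpha> x"
  by (simp add: christoffel_g partial_deriv_g_sym[of x _ \<alpha> \<beta>])

lemma christoffel_trace:
  assumes "x \<in> U"
  shows "(\<Sum>\<gamma>\<in>UNIV. christoffel g \<gamma> \<gamma> \<beta> x) = 0"
proof -
  have "(\<Sum>\<gamma>\<in>UNIV. christoffel g \<gamma> \<gamma> \<beta> x) = (G x * partial_deriv \<beta> E x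
      - 2 * F x * partial_deriv \<beta> F x + E x * partial_deriv \<beta> G x) / (2 * D)"
    using exhaust_2[of \<beta>] assms
    by (auto simp: sum_2 christoffel_explicit partial_deriv_g21 first_derivs add_divide_distrib[symmetric])
  then show ?thesis using det_deriv[OF assms] by simp
qed

lemma lower_christoffel:
  assumes "x \<in> U"
  shows "partial_deriv \<gamma> (\<lambda>y. g y $ \<alpha> $ \<beta>) x = 2 * (\<Sum>\<delta>\<in>UNIV. g x $ \<alpha> $ \<delta> * christoffel g \<delta> \<beta> \<gamma> x)"
proof -
  have *: "E * ((G * a - F * b) / (2 * D)) + F * ((E * b - F * a) / (2 * D)) = (E * G - F * F) * a / (2 * D)"
    "F * ((G * a - F * b) / (2 * D)) + G * ((E * b - F * a) / (2 * D)) = (E * G - F * F) * b / (2 * D)"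
    for E F G a b :: real
    by (simp_all only: add_divide_distrib[symmetric] times_divide_eq_right)
       (rule arg_cong[where f = "\<lambda>z. z / (2 * D)"], algebra)+
  have "partial_deriv \<gamma> (\<lambda>y. g y $ \<alpha> $ \<beta>) x = partial_deriv \<alpha> (\<lambda>y. g y $ \<beta> $ \<gamma>) x"
    using codazzi[OF assms, of \<gamma> \<alpha> \<beta>] partial_deriv_g_sym[OF assms, of \<alpha> \<gamma> \<beta>] by simp
  also have "\<dots> = 2 * (\<Sum>\<delta>\<in>UNIV. g x $ \<alpha> $ \<delta> * christoffel g \<delta> \<beta> \<gamma> x)"
    using exhaust_2[of \<alpha>]
  proof
    assume "\<alpha> = 1"
    then show ?thesis
      by (simp only: sum_2 christoffel_explicit[OF assms] * det_g[OF assms]) (simp add: D_nz)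
  next
    assume "\<alpha> = 2"
    then show ?thesis
      by (simp only: sum_2 christoffel_explicit[OF assms] g21[OF assms] * det_g[OF assms]) (simp add: D_nz)
  qed
  finally show ?thesis .
qed

lemma smooth_inverse_g: "smooth_on U (\<lambda>x. matrix_inv (g x) $ \<alpha> $ \<beta>)"
proof -
  have *: "smooth_on U (\<lambda>x. inverse D * g x $ \<mu> $ \<nu>)" "smooth_on U (\<lambda>x. - inverse D * g x $ \<mu> $ \<nu>)" for \<mu> \<nu>
    by (intro smooth_on_mult smooth_on_const smooth_g open_U)+
  have "\<alpha> = 1 \<or> \<alpha> = 2" "\<beta> = 1 \<or> \<beta> = 2" by (rule exhaust_2)+
  then show ?thesis
    by (elim disjE; hypsubst)
       (rule smooth_on_cong[OF open_U *(1)[of 2 2]] smooth_on_cong[OF open_U *(2)[of 1 2]] 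
          smooth_on_cong[OF open_U *(1)[of 1 1]]; simp add: inverse_g field_simps; fail)+
qed

lemma smooth_christoffel: "smooth_on U (christoffel g \<gamma> \<alpha> \<beta>)"
proof (rule smooth_on_cong[OF open_U])
  show "smooth_on U (\<lambda>x. 1 / 2 * (matrix_inv (g x) $ \<gamma> $ 1 * partial_deriv 1 (\<lambda>y. g y $ \<alpha> $ \<beta>) x
     + matrix_inv (g x) $ \<gamma> $ 2 * partial_deriv 2 (\<lambda>y. g y $ \<alpha> $ \<beta>) x))"
    by (intro smooth_on_mult smooth_on_add smooth_on_const smooth_inverse_g smooth_partial_deriv_g open_U)
qed (simp add: christoffel_g sum_2)

text \<open>
  This is \<open>1/4 tr (g\<^sup>-\<^sup>1 \<partial>\<^sub>\<alpha> g g\<^sup>-\<^sup>1 \<partial>\<^sub>\<beta> g)\<close>. As \<open>\<Gamma>\<close> has zero trace and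
  divergence equal to twice this tensor, it is also the Ricci tensor of \<open>g\<close>.
\<close>

definition christoffel_square where
  "christoffel_square \<alpha> \<beta> x = (\<Sum>\<gamma>\<in>UNIV. \<Sum>\<delta>\<in>UNIV. christoffel g \<gamma> \<delta> \<alpha> x * christoffel g \<delta> \<gamma> \<beta> x)"

lemma christoffel_square_explicit:
  assumes "x \<in> U"
  shows "christoffel_square \<alpha> \<beta> x = (2 * partial_deriv \<alpha> F x * partial_deriv \<beta> F x
      - partial_deriv \<alpha> G x * partial_deriv \<beta> E x - partial_deriv \<alpha> E x * partial_deriv \<beta> G x) / (4 * D)"
proof -
  let ?K = "\<lambda>\<gamma> \<delta> \<alpha>. christoffel g \<gamma> \<delta> \<alpha> x"
  have tr: "?K 2 2 \<gamma> = - ?K 1 1 \<gamma>" for \<gamma>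
    using christoffel_trace[OF assms, of \<gamma>] by (simp add: sum_2)
  have c: "E x * ?K 1 2 \<gamma> - F x * ?K 1 1 \<gamma> = F x * ?K 1 1 \<gamma> + G x * ?K 2 1 \<gamma>" for \<gamma>
    using lower_christoffel[OF assms, of \<gamma> 1 2] lower_christoffel[OF assms, of \<gamma> 2 1] partial_deriv_g21[OF assms, of \<gamma>]
    by (simp add: sum_2 tr g21 assms)
  have d: "partial_deriv \<gamma> E x = 2 * (E x * ?K 1 1 \<gamma> + F x * ?K 2 1 \<gamma>)"
    "partial_deriv \<gamma> F x = 2 * (F x * ?K 1 1 \<gamma> + G x * ?K 2 1 \<gamma>)"
    "partial_deriv \<gamma> G x = 2 * (F x * ?K 1 2 \<gamma> - G x * ?K 1 1 \<gamma>)" for \<gamma>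
    using lower_christoffel[OF assms, of \<gamma> 1 1] lower_christoffel[OF assms, of \<gamma> 2 1]
      lower_christoffel[OF assms, of \<gamma> 2 2] partial_deriv_g21[OF assms, of \<gamma>]
    by (simp_all add: sum_2 tr g21 assms)
  have "4 * D * christoffel_square \<alpha> \<beta> x = 4 * (D * (2 * ?K 1 1 \<alpha> * ?K 1 1 \<beta> + ?K 1 2 \<alpha> * ?K 2 1 \<beta> + ?K 2 1 \<alpha> * ?K 1 2 \<beta>))"
    by (simp add: christoffel_square_def sum_2 tr)
  also have "\<dots> = 2 * (2 * (F x * ?K 1 1 \<alpha> + G x * ?K 2 1 \<alpha>)) * (2 * (F x * ?K 1 1 \<beta> + G x * ?K 2 1 \<beta>))
      - (2 * (F x * ?K 1 2 \<alpha> - G x * ?K 1 1 \<alpha>)) * (2 * (E x * ?K 1 1 \<beta> + F x * ?K 2 1 \<beta>))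
      - (2 * (E x * ?K 1 1 \<alpha> + F x * ?K 2 1 \<alpha>)) * (2 * (F x * ?K 1 2 \<beta> - G x * ?K 1 1 \<beta>))"
    unfolding trace_product_traceless[OF det_g[OF assms, symmetric] c c] by algebra
  also have "\<dots> = 2 * partial_deriv \<alpha> F x * partial_deriv \<beta> F x
      - partial_deriv \<alpha> G x * partial_deriv \<beta> E x - partial_deriv \<alpha> E x * partial_deriv \<beta> G x"
    unfolding d ..
  finally have "christoffel_square \<alpha> \<beta> x * (4 * D) = 2 * partial_deriv \<alpha> F x * partial_deriv \<beta> F x
      - partial_deriv \<alpha> G x * partial_deriv \<beta> E x - partial_deriv \<alpha> E x * partial_deriv \<beta> G x"
    by (simp only: mult.commute)
  moreover have "4 * D \<noteq> 0" using D_nz by simp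
  ultimately show ?thesis by (rule eq_divide_imp[rotated])
qed

text \<open>
  Here \<open>\<partial>\<^sub>\<gamma> g\<^sup>\<gamma>\<^sup>\<delta> = 0\<close>, so only second derivatives of \<open>g\<close> survive; after permuting
  indices they form \<open>g\<^sup>\<gamma>\<^sup>\<delta> \<partial>\<^sub>\<alpha> \<partial>\<^sub>\<beta> g\<^sub>\<gamma>\<^sub>\<delta>\<close>, which the twice differentiated determinant
  equation expresses by first derivatives. In matrix form this is the sigma model equation
  \<open>\<partial>\<^sub>a (g\<^sup>a\<^sup>b g\<^sup>-\<^sup>1 \<partial>\<^sub>b g) = 0\<close>, the vanishing of the fibre part of the Ricci tensor.
\<close>

lemma div_christoffel:
  assumes "x \<in> U"
  shows "(\<Sum>\<gamma>\<in>UNIV. partial_deriv \<gamma> (christoffel g \<gamma> \<alpha> \<beta>) x) = 2 * christoffel_square \<alpha> \<beta> x"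
proof -
  let ?h = "\<lambda>y. g y $ \<alpha> $ \<beta>"
  have [simp]: "partial_deriv \<gamma> (\<lambda>y. g y $ \<alpha> $ \<beta>) differentiable (at x)" for \<gamma>
    by (rule differentiable_partial_deriv_g[OF assms])
  have s: "partial_deriv 1 (partial_deriv 1 ?h) x = partial_deriv \<alpha> (partial_deriv \<beta> E) x"
    "partial_deriv 1 (partial_deriv 2 ?h) x = partial_deriv \<alpha> (partial_deriv \<beta> F) x"
    "partial_deriv 2 (partial_deriv 2 ?h) x = partial_deriv \<alpha> (partial_deriv \<beta> G) x"
    by (rule second_derivs[OF assms])+
  have c: "partial_deriv 2 (partial_deriv 1 ?h) x = partial_deriv 1 (partial_deriv 2 ?h) x"
    by (rule partial_deriv_commute[OF open_U smooth_g assms])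
  have "partial_deriv 1 (christoffel g 1 \<alpha> \<beta>) x
      = partial_deriv 1 (\<lambda>x. (G x * partial_deriv 1 ?h x - F x * partial_deriv 2 ?h x) / (2 * D)) x"
    by (rule partial_deriv_cong[OF open_U assms]) (simp add: christoffel_explicit)
  then have 1: "partial_deriv 1 (christoffel g 1 \<alpha> \<beta>) x = (G x * partial_deriv 1 (partial_deriv 1 ?h) x
      + partial_deriv 2 F x * partial_deriv 1 ?h x
      - (F x * partial_deriv 1 (partial_deriv 2 ?h) x + partial_deriv 2 E x * partial_deriv 2 ?h x)) / (2 * D)"
    using assms by (simp add: first_derivs)
  have "partial_deriv 2 (christoffel g 2 \<alpha> \<beta>) x
      = partial_deriv 2 (\<lambda>x. (E x * partial_deriv 2 ?h x - F x * partial_deriv 1 ?h x) / (2 * D)) x"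
    by (rule partial_deriv_cong[OF open_U assms]) (simp add: christoffel_explicit)
  then have 2: "partial_deriv 2 (christoffel g 2 \<alpha> \<beta>) x = (E x * partial_deriv 2 (partial_deriv 2 ?h) x
      + partial_deriv 2 E x * partial_deriv 2 ?h x
      - (F x * partial_deriv 1 (partial_deriv 2 ?h) x + partial_deriv 2 F x * partial_deriv 1 ?h x)) / (2 * D)"
    using assms by (simp add: c)
  have "(\<Sum>\<gamma>\<in>UNIV. partial_deriv \<gamma> (christoffel g \<gamma> \<alpha> \<beta>) x) =
     (G x * partial_deriv \<alpha> (partial_deriv \<beta> E) x - 2 * F x * partial_deriv \<alpha> (partial_deriv \<beta> F) x
    + E x * partial_deriv \<alpha> (partial_deriv \<beta> G) x) / (2 * D)"
    unfolding sum_2 1 2 s by (simp add: add_divide_distrib[symmetric] algebra_simps)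
  moreover have *: "2 * (X / (4 * D)) = X / (2 * D)" for X
    by simp
  ultimately show ?thesis
    unfolding det_deriv2[OF assms] christoffel_square_explicit[OF assms] by (simp only: *)
qed

text \<open>
  The Laplace-Beltrami operator of \<open>g\<close>: the first order terms are absent because the coordinates
  are harmonic.
\<close>

definition laplacian where
  "laplacian f x = (\<Sum>\<gamma>\<in>UNIV. \<Sum>\<delta>\<in>UNIV. matrix_inv (g x) $ \<gamma> $ \<delta> * partial_deriv \<gamma> (partial_deriv \<delta> f) x)"

lemma laplacian_explicit:
  assumes "x \<in> U" "smooth_on U f"
  shows "laplacian f x = (G x * partial_deriv 1 (partial_deriv 1 f) x
    - 2 * F x * partial_deriv 1 (partial_deriv 2 f) x + E x * partial_deriv 2 (partial_deriv 2 f) x) / D"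
  unfolding laplacian_def using D_nz partial_deriv_commute[OF open_U assms(2,1), of 1 2]
  by (simp add: sum_2 inverse_g assms field_simps)

lemma laplacian_cong:
  assumes "x \<in> U" "\<And>y. y \<in> U \<Longrightarrow> f y = h y"
  shows "laplacian f x = laplacian h x"
proof -
  have "partial_deriv \<gamma> (partial_deriv \<delta> f) x = partial_deriv \<gamma> (partial_deriv \<delta> h) x" for \<gamma> \<delta>
    by (intro partial_deriv_cong[OF open_U] assms)
  then show ?thesis by (simp add: laplacian_def)
qed

lemma laplacian_lincomb:
  assumes x: "x \<in> U" and s: "smooth_on U u" "smooth_on U v" "smooth_on U w"
  shows "laplacian (\<lambda>x. a * u x - b * v x - c * w x) x = a * laplacian u x - b * laplacian v x - c * laplacian w x"
proof -
  note d = smooth_on_differentiable[OF s(1)] smooth_on_differentiable[OF s(2)] smooth_on_differentiable[OF s(3)]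
  note d' = s[THEN smooth_on_partial_deriv, THEN smooth_on_differentiable, OF x]
  have "partial_deriv \<gamma> (partial_deriv \<delta> (\<lambda>x. a * u x - b * v x - c * w x)) x
     = partial_deriv \<gamma> (\<lambda>x. a * partial_deriv \<delta> u x - b * partial_deriv \<delta> v x - c * partial_deriv \<delta> w x) x" for \<gamma> \<delta>
    by (rule partial_deriv_cong[OF open_U x]) (simp add: d)
  then have e: "partial_deriv \<gamma> (partial_deriv \<delta> (\<lambda>x. a * u x - b * v x - c * w x)) x
     = a * partial_deriv \<gamma> (partial_deriv \<delta> u) x - b * partial_deriv \<gamma> (partial_deriv \<delta> v) x
       - c * partial_deriv \<gamma> (partial_deriv \<delta> w) x" for \<gamma> \<delta>
    by (simp add: d')
  show ?thesis
    unfolding laplacian_def sum_2 e by algebra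
qed

lemma div_grad:
  assumes x: "x \<in> U" and f: "smooth_on U f"
  shows "(\<Sum>\<gamma>\<in>UNIV. partial_deriv \<gamma> (\<lambda>x. \<Sum>\<delta>\<in>UNIV. matrix_inv (g x) $ \<gamma> $ \<delta> * partial_deriv \<delta> f x) x) = laplacian f x"
proof -
  let ?V = "\<lambda>\<gamma> x. \<Sum>\<delta>\<in>UNIV. matrix_inv (g x) $ \<gamma> $ \<delta> * partial_deriv \<delta> f x"
  have [simp]: "partial_deriv \<delta> f differentiable (at x)" for \<delta>
    using smooth_on_differentiable[OF smooth_on_partial_deriv[OF f] x] .
  have "partial_deriv 1 (?V 1) x
     = partial_deriv 1 (\<lambda>x. (G x * partial_deriv 1 f x - F x * partial_deriv 2 f x) / D) x"
    by (rule partial_deriv_cong[OF open_U x]) (simp add: sum_2 inverse_g diff_divide_distrib mult.commute)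
  then have 1: "partial_deriv 1 (?V 1) x = (G x * partial_deriv 1 (partial_deriv 1 f) x
      + partial_deriv 2 F x * partial_deriv 1 f x
      - (F x * partial_deriv 1 (partial_deriv 2 f) x + partial_deriv 2 E x * partial_deriv 2 f x)) / D"
    using x by (simp add: first_derivs)
  have "partial_deriv 2 (?V 2) x
     = partial_deriv 2 (\<lambda>x. (E x * partial_deriv 2 f x - F x * partial_deriv 1 f x) / D) x"
    by (rule partial_deriv_cong[OF open_U x]) (simp add: sum_2 inverse_g diff_divide_distrib mult.commute)
  then have 2: "partial_deriv 2 (?V 2) x = (E x * partial_deriv 2 (partial_deriv 2 f) x
      + partial_deriv 2 E x * partial_deriv 2 f x
      - (F x * partial_deriv 1 (partial_deriv 2 f) x + partial_deriv 2 F x * partial_deriv 1 f x)) / D"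
    using x by (simp add: partial_deriv_commute[OF open_U f x, of 2 1])
  have "(\<Sum>\<gamma>\<in>UNIV. partial_deriv \<gamma> (?V \<gamma>) x) = partial_deriv 1 (?V 1) x + partial_deriv 2 (?V 2) x"
    by (rule sum_2)
  then show ?thesis
    unfolding 1 2 laplacian_explicit[OF x f] by (simp add: add_divide_distrib[symmetric] algebra_simps)
qed

text \<open>
  In dimension two the square of a trace-free cubic form is a multiple of the metric. The
  factor is written through the \<open>11\<close> entry, for which \<open>g\<^sub>1\<^sub>1 \<noteq> 0\<close> is enough.
\<close>

lemma christoffel_square_isotropic:
  assumes x: "x \<in> U" and nz: "E x \<noteq> 0"
  defines "\<tau> \<equiv> christoffel_square 1 1 x / E x"
  shows "christoffel_square \<alpha> \<beta> x = \<tau> * g x $ \<alpha> $ \<beta>"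
proof -
  note t = det_deriv[OF x, of 1] det_deriv[OF x, of 2]
  note a = apolar_cubic[OF t[unfolded first_derivs[OF x]]]
  have "christoffel_square \<alpha> \<beta> x * E x = christoffel_square 1 1 x * g x $ \<alpha> $ \<beta>"
    using exhaust_2[of \<alpha>] exhaust_2[of \<beta>] a
    by (auto simp: christoffel_square_explicit x first_derivs g21 algebra_simps)
  then have "christoffel_square \<alpha> \<beta> x = christoffel_square 1 1 x * g x $ \<alpha> $ \<beta> / E x"
    by (rule eq_divide_imp[OF nz])
  then show ?thesis by (simp add: \<tau>_def)
qed

text \<open>
  With \<open>\<tau>\<close> the factor from \<open>christoffel_square_isotropic\<close> and \<open>f = g\<^sub>\<mu>\<^sub>\<mu>\<close>, one has
  \<open>\<Delta> f = 4 \<tau> f\<close> and \<open>\<bar>\<nabla> f\<bar>\<^sup>2 = 2 \<tau> f\<^sup>2\<close>, whence \<open>\<Delta> (ln f) = 4 \<tau> - 2 \<tau>\<close>. The value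
  does not depend on \<open>\<mu>\<close>: this is why only the sum of the two exponents in \<open>\<Phi>\<close> matters.
\<close>

lemma laplacian_ln_diag:
  assumes x: "x \<in> U" and pos: "\<And>y. y \<in> U \<Longrightarrow> g y $ \<mu> $ \<mu> > 0" and "E x \<noteq> 0"
  shows "laplacian (\<lambda>y. ln (g y $ \<mu> $ \<mu>)) x = 2 * (christoffel_square 1 1 x / E x)"
proof -
  let ?f = "\<lambda>y. g y $ \<mu> $ \<mu>"
  have s: "smooth_on U (\<lambda>y. ln (?f y))"
    by (intro smooth_on_ln smooth_g open_U pos)
  have p: "partial_deriv \<delta> (partial_deriv \<gamma> (\<lambda>y. ln (?f y))) x = 
    partial_deriv \<delta> (partial_deriv \<gamma> ?f) x / ?f x - partial_deriv \<delta> ?f x * partial_deriv \<gamma> ?f x / (?f x)^2" for \<gamma> \<delta>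
  proof -
    have "partial_deriv \<delta> (partial_deriv \<gamma> (\<lambda>y. ln (?f y))) x = partial_deriv \<delta> (\<lambda>y. partial_deriv \<gamma> ?f y / ?f y) x"
      by (rule partial_deriv_cong[OF open_U x]) (simp add: pos)
    then show ?thesis using x pos[OF x] by (simp add: partial_deriv_divide diff_divide_distrib power2_eq_square)
  qed
  have m: "\<mu> = 1 \<or> \<mu> = 2" by (rule exhaust_2)
  have four: "4 * (X / (4 * D)) = X / D" for X
    by simp
  have k: "4 * christoffel_square \<mu> \<mu> x = (G x * partial_deriv 1 (partial_deriv 1 ?f) x
    - 2 * F x * partial_deriv 1 (partial_deriv 2 ?f) x + E x * partial_deriv 2 (partial_deriv 2 ?f) x) / D"
    unfolding second_derivs[OF x, of _ _ \<mu> \<mu>] det_deriv2[OF x] christoffel_square_explicit[OF x] by (simp only: four)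
  have t: "G x * partial_deriv 1 E x - 2 * F x * partial_deriv 2 E x + E x * partial_deriv 2 F x = 0"
    "G x * partial_deriv 2 E x - 2 * F x * partial_deriv 2 F x + E x * partial_deriv 2 G x = 0"
    using det_deriv[OF x, of 1] det_deriv[OF x, of 2] by (simp_all add: first_derivs x)
  have *: "E * (b * b - a * c) = G * a^2 - 2 * F * a * b + E * b^2"
    "G * (c * c - b * d) = G * c^2 - 2 * F * c * d + E * d^2"
    if "G * a - 2 * F * b + E * c = 0" "G * b - 2 * F * c + E * d = 0" for E F G a b c d :: real
    using that by algebra+
  have half: "2 * ((2 * b * b - c * a - a * c) / (4 * D)) * y = y * (b * b - a * c) / D" for a b c y
  proof -
    have "2 * b * b - c * a - a * c = 2 * (b * b - a * c)" by algebra
    moreover have "2 * (2 * z / (4 * D)) * y = y * z / D" for z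
      by simp
    ultimately show ?thesis by (simp only:)
  qed
  have "2 * christoffel_square \<mu> \<mu> x * ?f x = (?f x * (partial_deriv \<mu> F x * partial_deriv \<mu> F x
      - partial_deriv \<mu> E x * partial_deriv \<mu> G x)) / D"
    unfolding christoffel_square_explicit[OF x] by (rule half)
  also have "\<dots> = (G x * (partial_deriv 1 ?f x)^2
    - 2 * F x * partial_deriv 1 ?f x * partial_deriv 2 ?f x + E x * (partial_deriv 2 ?f x)^2) / D"
    using m by (auto simp: first_derivs x *[OF t])
  finally have q: "2 * christoffel_square \<mu> \<mu> x * ?f x = (G x * (partial_deriv 1 ?f x)^2
    - 2 * F x * partial_deriv 1 ?f x * partial_deriv 2 ?f x + E x * (partial_deriv 2 ?f x)^2) / D" .
  have alg: "(g2 * (a1 / y - b1 * b1 / y\<^sup>2) - 2 * g12 * (a12 / y - b1 * b2 / y\<^sup>2) + g1 * (a2 / y - b2 * b2 / y\<^sup>2)) / d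
    = (g2 * a1 - 2 * g12 * a12 + g1 * a2) / d / y - (g2 * b1\<^sup>2 - 2 * g12 * b1 * b2 + g1 * b2\<^sup>2) / d / y\<^sup>2"
    for g1 g2 g12 a1 a2 a12 b1 b2 y d :: real
    by (simp only: divide_inverse power2_eq_square) algebra
  have f0: "?f x \<noteq> 0" using pos[OF x] by simp
  have "laplacian (\<lambda>y. ln (?f y)) x = 4 * christoffel_square \<mu> \<mu> x / ?f x - 2 * christoffel_square \<mu> \<mu> x * ?f x / (?f x)^2"
    unfolding laplacian_explicit[OF x s] p k q
    by (rule alg)
  also have "\<dots> = 2 * (christoffel_square \<mu> \<mu> x / ?f x)"
    using f0 by (simp add: power2_eq_square)
  also have "\<dots> = 2 * (christoffel_square 1 1 x / E x)"
    using christoffel_square_isotropic[OF x assms(3), of \<mu> \<mu>] f0 by simp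
  finally show ?thesis .
qed

end

section \<open>Functions and sums over the base and the fibre coordinates\<close>

lemma sum_total:
  "(\<Sum>i\<in>(UNIV :: ('a::finite + 'b::finite \<times> 'n::finite) set). f i) =
     (\<Sum>\<alpha>\<in>UNIV. f (Inl \<alpha>)) + (\<Sum>k\<in>UNIV. \<Sum>\<alpha>\<in>UNIV. f (Inr (\<alpha>, k)))"
proof -
  have "(\<Sum>i\<in>(UNIV :: ('a + 'b \<times> 'n) set). f i)
      = (\<Sum>\<alpha>\<in>UNIV. f (Inl \<alpha>)) + (\<Sum>p\<in>UNIV. f (Inr p))"
    by (simp add: UNIV_Plus_UNIV[symmetric] sum.Plus del: UNIV_Plus_UNIV)
  also have "(\<Sum>p\<in>UNIV. f (Inr p)) = (\<Sum>\<alpha>\<in>UNIV. \<Sum>k\<in>UNIV. f (Inr (\<alpha>, k)))"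
    by (simp add: UNIV_Times_UNIV[symmetric] sum.cartesian_product del: UNIV_Times_UNIV)
  also have "\<dots> = (\<Sum>k\<in>UNIV. \<Sum>\<alpha>\<in>UNIV. f (Inr (\<alpha>, k)))"
    by (rule sum.swap)
  finally show ?thesis .
qed

text \<open>
  Both factors are block diagonal in the fibre index, so a contraction over an intermediate fibre
  coordinate collapses to the single block \<open>q = k\<close>.
\<close>

lemma sum_fibre:
  fixes f h :: "'n::finite \<Rightarrow> 'a::finite \<Rightarrow> real"
  shows "(\<Sum>q\<in>UNIV. \<Sum>\<alpha>\<in>UNIV. (if k = q then f q \<alpha> else 0) * (if q = l then h q \<alpha> else 0))
    = (if k = l then \<Sum>\<alpha>\<in>UNIV. f k \<alpha> * h k \<alpha> else 0)"
proof -
  have "(\<Sum>\<alpha>\<in>UNIV. (if k = q then f q \<alpha> else 0) * (if q = l then h q \<alpha> else 0))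
    = (if q = k then if k = l then \<Sum>\<alpha>\<in>UNIV. f k \<alpha> * h k \<alpha> else 0 else 0)" for q
    by auto
  then show ?thesis by simp
qed

lemma sum_fibre_product:
  fixes f h :: "'n::finite \<Rightarrow> 'a::finite \<Rightarrow> 'b::finite \<Rightarrow> real"
  shows "(\<Sum>q\<in>UNIV. \<Sum>\<alpha>\<in>UNIV. \<Sum>\<beta>\<in>UNIV. (if q = k then f q \<alpha> \<beta> else 0) * (if q = l then h q \<alpha> \<beta> else 0))
    = (if k = l then \<Sum>\<alpha>\<in>UNIV. \<Sum>\<beta>\<in>UNIV. f k \<alpha> \<beta> * h k \<alpha> \<beta> else 0)"
proof -
  have "(\<Sum>\<alpha>\<in>UNIV. \<Sum>\<beta>\<in>UNIV. (if q = k then f q \<alpha> \<beta> else 0) * (if q = l then h q \<alpha> \<beta> else 0))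
    = (if q = k then if k = l then \<Sum>\<alpha>\<in>UNIV. \<Sum>\<beta>\<in>UNIV. f k \<alpha> \<beta> * h k \<alpha> \<beta> else 0 else 0)" for q
    by auto
  then show ?thesis by simp
qed

lemma base_point_add:
  "base_point (z + t *\<^sub>R axis (Inl \<alpha>) 1) = base_point z + t *\<^sub>R axis \<alpha> 1"
  "base_point (z + t *\<^sub>R axis (Inr p) 1) = base_point z"
  by (auto simp: base_point_def vec_eq_iff axis_def)

text \<open>
  Moving along a coordinate axis upstairs moves the base point along the corresponding axis or not at
  all, so these equations hold for arbitrary \<open>f\<close>, differentiable or not.
\<close>

lemma partial_deriv_base_point:
  "partial_deriv (Inl \<alpha>) (\<lambda>z. f (base_point z)) z = partial_deriv \<alpha> f (base_point z)"
  "partial_deriv (Inr p) (\<lambda>z. f (base_point z)) z = 0"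
  by (simp_all add: partial_deriv_def base_point_add)

lemma bounded_linear_base_point: "bounded_linear base_point"
  by (simp add: linear_conv_bounded_linear[symmetric] linear_iff base_point_def vec_eq_iff)

lemma continuous_on_base_point: "continuous_on S base_point"
  by (rule linear_continuous_on[OF bounded_linear_base_point])

lemma open_cylinder: "open U \<Longrightarrow> open (cylinder U)"
  using open_vimage[OF _ continuous_on_base_point, of U]
  by (simp add: vimage_def cylinder_def)

lemma Ck_on_base_point:
  "Ck_on k U f \<Longrightarrow> Ck_on k (cylinder U) (\<lambda>z :: real ^ (2 + 2 \<times> 'n::finite). f (base_point z))"
proof (induction k arbitrary: f)
  case 0
  have "continuous_on (base_point ` cylinder U) f"
    using 0 by (auto intro: continuous_on_subset simp: cylinder_def)
  then have "continuous_on (cylinder U) (f \<circ> base_point)"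
    by (rule continuous_on_compose[OF continuous_on_base_point])
  then show ?case by (simp add: comp_def)
next
  case (Suc k)
  have "(\<lambda>z. f (base_point z)) differentiable (at z)" if "z \<in> cylinder U"
    for z :: "real ^ (2 + 2 \<times> 'n)"
  proof -
    have "f differentiable (at (base_point z))"
      using that Suc.prems by (simp add: cylinder_def)
    moreover have "base_point differentiable (at z)"
      by (rule bounded_linear_imp_differentiable[OF bounded_linear_base_point])
    ultimately show ?thesis
      using differentiable_chain_at[of base_point z f] by (simp add: comp_def)
  qed
  moreover have "Ck_on k (cylinder U) (partial_deriv i (\<lambda>z. f (base_point z)))" for i :: "2 + 2 \<times> 'n"
  proof (cases i)
    case (Inl \<alpha>)
    have "partial_deriv i (\<lambda>z. f (base_point z)) = (\<lambda>z. partial_deriv \<alpha> f (base_point z))"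
      unfolding Inl by (rule ext) (rule partial_deriv_base_point)
    with Suc show ?thesis by simp
  next
    case (Inr p)
    have "partial_deriv i (\<lambda>z. f (base_point z)) = (\<lambda>z. 0)"
      unfolding Inr by (rule ext) (rule partial_deriv_base_point)
    then show ?thesis by (simp add: Ck_on_const)
  qed
  ultimately show ?case by simp
qed

lemma smooth_on_base_point:
  "smooth_on U f \<Longrightarrow> smooth_on (cylinder U) (\<lambda>z. f (base_point z))"
  by (simp add: smooth_on_def Ck_on_base_point)

lemma total_metric_simps [simp]:
  "total_metric g \<Phi> e z $ Inl \<alpha> $ Inl \<beta> = exp (2 * \<Phi> (base_point z)) * g (base_point z) $ \<alpha> $ \<beta>"
  "total_metric g \<Phi> e z $ Inl \<alpha> $ Inr p = 0"
  "total_metric g \<Phi> e z $ Inr p $ Inl \<alpha> = 0"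
  "total_metric g \<Phi> e z $ Inr (\<alpha>, k) $ Inr (\<beta>, l) =
     (if k = l then e k * g (base_point z) $ \<alpha> $ \<beta> else 0)"
  by (simp_all add: total_metric_def split: prod.splits)

section \<open>The Ricci tensor of the total metric\<close>

text \<open>
  The shape of the Christoffel symbols of a block metric whose coefficients depend on the base point
  only: an even number of fibre indices, all of them in the same fibre block. The same shape is
  inherited by the derivatives along the base, which is why the three families of components are
  parameters.
\<close>

fun block_christoffel ::
    "('a \<Rightarrow> 'a \<Rightarrow> 'a \<Rightarrow> real) \<Rightarrow> ('n \<Rightarrow> 'a \<Rightarrow> 'a \<Rightarrow> 'a \<Rightarrow> real) \<Rightarrow> ('a \<Rightarrow> 'a \<Rightarrow> 'a \<Rightarrow> real) \<Rightarrow>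
     'a + 'a \<times> 'n \<Rightarrow> 'a + 'a \<times> 'n \<Rightarrow> 'a + 'a \<times> 'n \<Rightarrow> real" where
  "block_christoffel C P K (Inl \<gamma>) (Inl \<alpha>) (Inl \<beta>) = C \<gamma> \<alpha> \<beta>"
| "block_christoffel C P K (Inl \<gamma>) (Inr (\<alpha>, k)) (Inr (\<beta>, l)) = (if k = l then P k \<gamma> \<alpha> \<beta> else 0)"
| "block_christoffel C P K (Inr (\<gamma>, k)) (Inl \<alpha>) (Inr (\<beta>, l)) = (if k = l then K \<gamma> \<alpha> \<beta> else 0)"
| "block_christoffel C P K (Inr (\<gamma>, k)) (Inr (\<alpha>, l)) (Inl \<beta>) = (if k = l then K \<gamma> \<alpha> \<beta> else 0)"
| "block_christoffel C P K (Inl \<gamma>) (Inl \<alpha>) (Inr q) = 0"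
| "block_christoffel C P K (Inl \<gamma>) (Inr p) (Inl \<beta>) = 0"
| "block_christoffel C P K (Inr r) (Inl \<alpha>) (Inl \<beta>) = 0"
| "block_christoffel C P K (Inr r) (Inr p) (Inr q) = 0"

text \<open>
  The quadratic part of the Ricci tensor under the conformal change \<open>g \<mapsto> exp (2 \<Phi>) g\<close>,
  as an identity at one point: \<open>h\<close> is the metric, \<open>K\<close> its Christoffel symbols, \<open>p\<close> the
  differential and \<open>v\<close> the gradient of \<open>\<Phi>\<close>. In dimension two all terms quadratic in
  \<open>p\<close> cancel. With \<open>p\<close> replaced by \<open>h v\<close> the identity becomes polynomial, so no division by
  \<open>det h\<close> occurs.
\<close>

lemma conformal_algebra:
  fixes K :: "2 \<Rightarrow> 2 \<Rightarrow> 2 \<Rightarrow> real" and h :: "2 \<Rightarrow> 2 \<Rightarrow> real" and v p :: "2 \<Rightarrow> real"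
  assumes symK: "\<And>\<gamma> \<alpha> \<beta>. K \<gamma> \<alpha> \<beta> = K \<gamma> \<beta> \<alpha>"
    and tr: "\<And>\<beta>. (\<Sum>\<gamma>\<in>UNIV. K \<gamma> \<gamma> \<beta>) = 0"
    and symh: "\<And>\<alpha> \<beta>. h \<alpha> \<beta> = h \<beta> \<alpha>"
    and low: "\<And>\<alpha> \<beta> \<gamma>. (\<Sum>\<delta>\<in>UNIV. h \<alpha> \<delta> * K \<delta> \<beta> \<gamma>) = (\<Sum>\<delta>\<in>UNIV. h \<beta> \<delta> * K \<delta> \<alpha> \<gamma>)"
    and p: "\<And>\<gamma>. p \<gamma> = (\<Sum>\<delta>\<in>UNIV. h \<gamma> \<delta> * v \<delta>)"
    and C: "\<And>\<gamma> \<alpha> \<beta>. C \<gamma> \<alpha> \<beta> = K \<gamma> \<alpha> \<beta> + (if \<gamma> = \<beta> then p \<alpha> else 0) + (if \<gamma> = \<alpha> then p \<beta> else 0)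
           - h \<alpha> \<beta> * v \<gamma>"
  shows "(\<Sum>\<gamma>\<in>UNIV. \<Sum>\<delta>\<in>UNIV. C \<gamma> \<gamma> \<delta> * C \<delta> \<beta> \<alpha> - C \<gamma> \<beta> \<delta> * C \<delta> \<gamma> \<alpha>)
    = (\<Sum>\<gamma>\<in>UNIV. 2 * (\<Sum>\<delta>\<in>UNIV. h \<gamma> \<delta> * K \<delta> \<beta> \<alpha>) * v \<gamma>)
      - (\<Sum>\<gamma>\<in>UNIV. \<Sum>\<delta>\<in>UNIV. K \<gamma> \<beta> \<delta> * K \<delta> \<gamma> \<alpha>)"
proof -
  have k: "K 2 2 1 = - K 1 1 1" "K 2 1 2 = - K 1 1 1" "K 1 2 1 = K 1 1 2" "K 2 2 2 = - K 1 1 2"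
    using tr[of 1] tr[of 2] symK[of 2 1 2] symK[of 1 2 1] by (simp_all add: sum_2)
  have h: "h 2 1 = h 1 2" by (rule symh)
  have c: "h 1 1 * K 1 1 2 - 2 * h 1 2 * K 1 1 1 = h 2 2 * K 2 1 1"
    "h 1 1 * K 1 2 2 - 2 * h 1 2 * K 1 1 2 + h 2 2 * K 1 1 1 = 0"
    using low[of 1 2 1] low[of 1 2 2] by (simp_all add: sum_2 k h)
  have pp: "p 1 = h 1 1 * v 1 + h 1 2 * v 2" "p 2 = h 1 2 * v 1 + h 2 2 * v 2"
    by (simp_all add: p sum_2 h)
  have n: "(1::2) \<noteq> 2" "(2::2) \<noteq> 1" by simp_all
  have CC: "C 1 1 1 = K 1 1 1 + p 1 + p 1 - h 1 1 * v 1" "C 1 1 2 = K 1 1 2 + p 2 - h 1 2 * v 1"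
    "C 1 2 1 = K 1 1 2 + p 2 - h 1 2 * v 1" "C 1 2 2 = K 1 2 2 - h 2 2 * v 1"
    "C 2 1 1 = K 2 1 1 - h 1 1 * v 2" "C 2 1 2 = - K 1 1 1 + p 1 - h 1 2 * v 2"
    "C 2 2 1 = - K 1 1 1 + p 1 - h 1 2 * v 2" "C 2 2 2 = - K 1 1 2 + p 2 + p 2 - h 2 2 * v 2"
    by (simp_all add: C k h n)
  have "\<forall>\<alpha> \<beta>. (\<Sum>\<gamma>\<in>UNIV. \<Sum>\<delta>\<in>UNIV. C \<gamma> \<gamma> \<delta> * C \<delta> \<beta> \<alpha> - C \<gamma> \<beta> \<delta> * C \<delta> \<gamma> \<alpha>)
    = (\<Sum>\<gamma>\<in>UNIV. 2 * (\<Sum>\<delta>\<in>UNIV. h \<gamma> \<delta> * K \<delta> \<beta> \<alpha>) * v \<gamma>)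
      - (\<Sum>\<gamma>\<in>UNIV. \<Sum>\<delta>\<in>UNIV. K \<gamma> \<beta> \<delta> * K \<delta> \<gamma> \<alpha>)"
    unfolding forall_2 sum_2 CC k h pp
    using c by (intro conjI) algebra+
  then show ?thesis by blast
qed

context hessian_metric
begin

context
  fixes \<Phi> :: "real ^ 2 \<Rightarrow> real" and e :: "'n::finite \<Rightarrow> real"
  assumes smooth_\<Phi>: "smooth_on U \<Phi>" and e: "\<And>k. e k \<in> {1, - 1}"
begin

abbreviation "total_g \<equiv> total_metric g \<Phi> e"
abbreviation "grad \<equiv> \<lambda>\<gamma> x. \<Sum>\<delta>\<in>UNIV. matrix_inv (g x) $ \<gamma> $ \<delta> * partial_deriv \<delta> \<Phi> x"

lemma inverse_mult:
  assumes "x \<in> U"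
  shows "(\<Sum>\<delta>\<in>UNIV. g x $ \<alpha> $ \<delta> * matrix_inv (g x) $ \<delta> $ \<beta>) = (if \<alpha> = \<beta> then 1 else 0)"
    and "(\<Sum>\<delta>\<in>UNIV. matrix_inv (g x) $ \<alpha> $ \<delta> * g x $ \<beta> $ \<delta>) = (if \<alpha> = \<beta> then 1 else 0)"
proof -
  have d: "(E x * G x) / D - (F x * F x) / D = 1"
    using det_g[OF assms] D_nz by (simp add: diff_divide_distrib[symmetric])
  show "(\<Sum>\<delta>\<in>UNIV. g x $ \<alpha> $ \<delta> * matrix_inv (g x) $ \<delta> $ \<beta>) = (if \<alpha> = \<beta> then 1 else 0)"
    "(\<Sum>\<delta>\<in>UNIV. matrix_inv (g x) $ \<alpha> $ \<delta> * g x $ \<beta> $ \<delta>) = (if \<alpha> = \<beta> then 1 else 0)"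
    using exhaust_2[of \<alpha>] exhaust_2[of \<beta>] d assms
    by (auto simp: sum_2 inverse_g g21 mult.commute)
qed

definition total_inverse :: "real ^ 2 \<Rightarrow> real ^ (2 + 2 \<times> 'n) ^ (2 + 2 \<times> 'n)" where
  "total_inverse x = (\<chi> i j. case (i, j) of
        (Inl \<alpha>, Inl \<beta>) \<Rightarrow> exp (- (2 * \<Phi> x)) * matrix_inv (g x) $ \<alpha> $ \<beta>
      | (Inr (\<alpha>, k), Inr (\<beta>, l)) \<Rightarrow> (if k = l then e k * matrix_inv (g x) $ \<alpha> $ \<beta> else 0)
      | _ \<Rightarrow> 0)"

lemma total_inverse_simps [simp]:
  "total_inverse x $ Inl \<alpha> $ Inl \<beta> = exp (- (2 * \<Phi> x)) * matrix_inv (g x) $ \<alpha> $ \<beta>"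
  "total_inverse x $ Inl \<alpha> $ Inr p = 0"
  "total_inverse x $ Inr p $ Inl \<alpha> = 0"
  "total_inverse x $ Inr (\<alpha>, k) $ Inr (\<beta>, l) = (if k = l then e k * matrix_inv (g x) $ \<alpha> $ \<beta> else 0)"
  by (simp_all add: total_inverse_def split: prod.splits)

lemma sign_square: "e k * e k = 1"
  using e[of k] by auto

lemma total_mult_inverse:
  assumes "base_point z \<in> U"
  shows "total_g z ** total_inverse (base_point z) = mat 1"
proof -
  have "(total_g z ** total_inverse (base_point z)) $ i $ j = mat 1 $ i $ j" for i j
  proof (cases i; cases j)
    fix \<alpha> \<beta> assume "i = Inl \<alpha>" "j = Inl \<beta>"
    then have "(total_g z ** total_inverse (base_point z)) $ i $ j
        = (\<Sum>\<delta>\<in>UNIV. (exp (2 * \<Phi> (base_point z)) * g (base_point z) $ \<alpha> $ \<delta>) *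
            (exp (- (2 * \<Phi> (base_point z))) * matrix_inv (g (base_point z)) $ \<delta> $ \<beta>))"
      by (simp add: matrix_matrix_mult_def sum_total)
    also have "\<dots> = (\<Sum>\<delta>\<in>UNIV. g (base_point z) $ \<alpha> $ \<delta> * matrix_inv (g (base_point z)) $ \<delta> $ \<beta>)"
      by (intro sum.cong refl) (simp add: exp_minus)
    also have "\<dots> = mat 1 $ i $ j"
      unfolding inverse_mult(1)[OF assms] using \<open>i = Inl \<alpha>\<close> \<open>j = Inl \<beta>\<close> by (simp add: mat_def)
    finally show ?thesis .
  next
    fix p q assume "i = Inr p" "j = Inr q"
    moreover obtain \<alpha> k \<beta> l where "p = (\<alpha>, k)" "q = (\<beta>, l)"
      by (meson surj_pair)
    ultimately have "(total_g z ** total_inverse (base_point z)) $ i $ j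
        = (if k = l then \<Sum>\<delta>\<in>UNIV. (e k * g (base_point z) $ \<alpha> $ \<delta>) *
            (e k * matrix_inv (g (base_point z)) $ \<delta> $ \<beta>) else 0)"
      by (simp add: matrix_matrix_mult_def sum_total sum_fibre)
    also have "\<dots> = (if k = l then \<Sum>\<delta>\<in>UNIV. (e k * e k) * (g (base_point z) $ \<alpha> $ \<delta> * matrix_inv (g (base_point z)) $ \<delta> $ \<beta>) else 0)"
      by (simp only: ac_simps)
    also have "\<dots> = mat 1 $ i $ j"
      unfolding sign_square mult_1 inverse_mult(1)[OF assms] using \<open>i = Inr p\<close> \<open>j = Inr q\<close> \<open>p = _\<close> \<open>q = _\<close>
      by (simp add: mat_def)
    finally show ?thesis .
  qed (simp_all add: matrix_matrix_mult_def sum_total mat_def split_paired_all)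
  then show ?thesis by (simp add: vec_eq_iff)
qed

lemma matrix_inv_total:
  "base_point z \<in> U \<Longrightarrow> matrix_inv (total_g z) = total_inverse (base_point z)"
  by (rule matrix_inv_eqI[OF total_mult_inverse])

lemma pseudo_riemannian_total: "pseudo_riemannian_metric_on (cylinder U) total_g"
  unfolding pseudo_riemannian_metric_on_def
proof (intro conjI allI ballI)
  fix i j
  have base: "smooth_on (cylinder U) (\<lambda>z::real ^ (2 + 2 \<times> 'n). exp (2 * \<Phi> (base_point z)) * g (base_point z) $ \<alpha> $ \<beta>)" for \<alpha> \<beta>
    by (intro smooth_on_mult smooth_on_exp smooth_on_const smooth_on_base_point[OF smooth_\<Phi>]
        smooth_on_base_point[OF smooth_g] open_cylinder open_U)
  have fib: "smooth_on (cylinder U) (\<lambda>z::real ^ (2 + 2 \<times> 'n). if k = l then e k * g (base_point z) $ \<alpha> $ \<beta> else 0)" for \<alpha> \<beta> k l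
    by (cases "k = l", simp_all) (intro smooth_on_mult smooth_on_const smooth_on_base_point[OF smooth_g] open_cylinder open_U)
  show "smooth_on (cylinder U) (\<lambda>z. total_g z $ i $ j)"
    by (cases i; cases j) (auto simp: base fib split_paired_all)
next
  fix z :: "real ^ (2 + 2 \<times> 'n)" assume "z \<in> cylinder U"
  then have z: "base_point z \<in> U" by (simp add: cylinder_def)
  have "total_g z $ j $ i = total_g z $ i $ j" for i j
    by (cases i; cases j) (auto simp: sym_g[OF z] split_paired_all)
  then show "transpose (total_g z) = total_g z" by (simp add: transpose_def vec_eq_iff)
  show "invertible (total_g z)"
    using total_mult_inverse[OF z] matrix_left_right_inverse unfolding invertible_def by blast
qed

lemma total_cong: "base_point z = base_point z' \<Longrightarrow> total_g z = total_g z'"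
  by (simp only: total_metric_def)

lemma partial_deriv_total_fibre: "partial_deriv (Inr p) (\<lambda>z. total_g z $ i $ j) z = 0"
proof -
  have "total_g (z + t *\<^sub>R axis (Inr p) 1) = total_g z" for t
    by (rule total_cong) (rule base_point_add)
  then show ?thesis by (simp add: partial_deriv_def)
qed

lemma partial_deriv_total_base:
  assumes "base_point z \<in> U"
  shows "partial_deriv (Inl \<gamma>) (\<lambda>z. total_g z $ Inl \<alpha> $ Inl \<beta>) z
    = exp (2 * \<Phi> (base_point z)) * (2 * partial_deriv \<gamma> \<Phi> (base_point z) * g (base_point z) $ \<alpha> $ \<beta>
        + partial_deriv \<gamma> (\<lambda>x. g x $ \<alpha> $ \<beta>) (base_point z))"
  "partial_deriv (Inl \<gamma>) (\<lambda>z. total_g z $ Inl \<alpha> $ Inr q) z = 0"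
  "partial_deriv (Inl \<gamma>) (\<lambda>z. total_g z $ Inr q $ Inl \<alpha>) z = 0"
  "partial_deriv (Inl \<gamma>) (\<lambda>z. total_g z $ Inr (\<alpha>, k) $ Inr (\<beta>, l)) z
    = (if k = l then e k * partial_deriv \<gamma> (\<lambda>x. g x $ \<alpha> $ \<beta>) (base_point z) else 0)"
proof -
  have d: "\<Phi> differentiable (at (base_point z))" by (rule smooth_on_differentiable[OF smooth_\<Phi> assms])
  show "partial_deriv (Inl \<gamma>) (\<lambda>z. total_g z $ Inl \<alpha> $ Inl \<beta>) z
    = exp (2 * \<Phi> (base_point z)) * (2 * partial_deriv \<gamma> \<Phi> (base_point z) * g (base_point z) $ \<alpha> $ \<beta>
        + partial_deriv \<gamma> (\<lambda>x. g x $ \<alpha> $ \<beta>) (base_point z))"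
    unfolding total_metric_simps partial_deriv_base_point(1)[of \<gamma> "\<lambda>x. exp (2 * \<Phi> x) * g x $ \<alpha> $ \<beta>"]
    using d assms by (simp add: algebra_simps)
  show "partial_deriv (Inl \<gamma>) (\<lambda>z. total_g z $ Inl \<alpha> $ Inr q) z = 0"
    "partial_deriv (Inl \<gamma>) (\<lambda>z. total_g z $ Inr q $ Inl \<alpha>) z = 0"
    by simp_all
  show "partial_deriv (Inl \<gamma>) (\<lambda>z. total_g z $ Inr (\<alpha>, k) $ Inr (\<beta>, l)) z
    = (if k = l then e k * partial_deriv \<gamma> (\<lambda>x. g x $ \<alpha> $ \<beta>) (base_point z) else 0)"
    unfolding total_metric_simps partial_deriv_base_point(1)[of \<gamma> "\<lambda>x. if k = l then e k * g x $ \<alpha> $ \<beta> else 0"]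
    using assms by simp
qed

text \<open>
  The Christoffel symbols of the conformal metric \<open>exp (2 \<Phi>) g\<close>.
\<close>

definition "base_christoffel \<gamma> \<alpha> \<beta> x = christoffel g \<gamma> \<alpha> \<beta> x
  + (if \<gamma> = \<beta> then partial_deriv \<alpha> \<Phi> x else 0) + (if \<gamma> = \<alpha> then partial_deriv \<beta> \<Phi> x else 0)
  - g x $ \<alpha> $ \<beta> * grad \<gamma> x"

definition "fibre_christoffel k \<gamma> \<alpha> \<beta> x = - (e k * exp (- (2 * \<Phi> x)) * christoffel g \<gamma> \<alpha> \<beta> x)"

lemma christoffel_total:
  assumes z: "base_point z \<in> U"
  shows "christoffel total_g a b c z = block_christoffel (\<lambda>\<gamma> \<alpha> \<beta>. base_christoffel \<gamma> \<alpha> \<beta> (base_point z))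
     (\<lambda>k \<gamma> \<alpha> \<beta>. fibre_christoffel k \<gamma> \<alpha> \<beta> (base_point z)) (\<lambda>\<gamma> \<alpha> \<beta>. christoffel g \<gamma> \<alpha> \<beta> (base_point z)) a b c"
proof -
  define x where "x = base_point z"
  have x: "x \<in> U" using z by (simp add: x_def)
  note simps = christoffel_def[of total_g] sum_total matrix_inv_total[OF z] partial_deriv_total_fibre
    partial_deriv_total_base[OF z] total_inverse_simps x_def[symmetric]
  have g\<delta>: "partial_deriv \<alpha> (\<lambda>y. g y $ \<beta> $ \<delta>) x = partial_deriv \<delta> (\<lambda>y. g y $ \<alpha> $ \<beta>) x" for \<alpha> \<beta> \<delta>
    using codazzi[OF x, of \<alpha> \<delta> \<beta>] partial_deriv_g_sym[OF x, of \<alpha> \<beta> \<delta>] by simp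
  \<comment> \<open>The signs of the fibre block cancel against those of its inverse.\<close>
  have mixed: "1 / 2 * (\<Sum>q\<in>UNIV. \<Sum>\<delta>\<in>UNIV. (if k = q then e k * matrix_inv (g x) $ \<gamma> $ \<delta> else 0) *
       (if q = l then e l * partial_deriv \<alpha> (\<lambda>x. g x $ \<beta> $ \<delta>) x else 0)) =
     (if k = l then christoffel g \<gamma> \<alpha> \<beta> x else 0)" for \<alpha> \<beta> \<gamma> k l
  proof -
    have "(\<Sum>\<delta>\<in>UNIV. e k * matrix_inv (g x) $ \<gamma> $ \<delta> * (e k * partial_deriv \<alpha> (\<lambda>x. g x $ \<beta> $ \<delta>) x))
      = (\<Sum>\<delta>\<in>UNIV. (e k * e k) * (matrix_inv (g x) $ \<gamma> $ \<delta> * partial_deriv \<delta> (\<lambda>x. g x $ \<alpha> $ \<beta>) x))"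
      unfolding g\<delta>[of \<alpha> \<beta>] by (simp only: ac_simps)
    then show ?thesis
      unfolding sum_fibre christoffel_g[OF x] sign_square by (cases "k = l") simp_all
  qed
  have halves: "1 / 2 * (2 * a + 2 * b - 2 * c + d) = a + b - c + 1 / 2 * d" for a b c d :: real
    by simp
  show ?thesis
  proof (cases a; cases b; cases c)
    fix \<gamma> \<alpha> \<beta> assume abc: "a = Inl \<gamma>" "b = Inl \<alpha>" "c = Inl \<beta>"
    have "christoffel total_g a b c z = 1 / 2 * (\<Sum>\<delta>\<in>UNIV. (exp (- (2 * \<Phi> x)) * matrix_inv (g x) $ \<gamma> $ \<delta>) *
       (exp (2 * \<Phi> x) * (2 * partial_deriv \<alpha> \<Phi> x * g x $ \<beta> $ \<delta> + partial_deriv \<alpha> (\<lambda>x. g x $ \<beta> $ \<delta>) x)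
      + exp (2 * \<Phi> x) * (2 * partial_deriv \<beta> \<Phi> x * g x $ \<alpha> $ \<delta> + partial_deriv \<beta> (\<lambda>x. g x $ \<alpha> $ \<delta>) x)
      - exp (2 * \<Phi> x) * (2 * partial_deriv \<delta> \<Phi> x * g x $ \<alpha> $ \<beta> + partial_deriv \<delta> (\<lambda>x. g x $ \<alpha> $ \<beta>) x)))"
      unfolding abc simps by simp
    also have "\<dots> = 1 / 2 * (\<Sum>\<delta>\<in>UNIV. (exp (- (2 * \<Phi> x)) * exp (2 * \<Phi> x)) *
        (2 * partial_deriv \<alpha> \<Phi> x * (matrix_inv (g x) $ \<gamma> $ \<delta> * g x $ \<beta> $ \<delta>)
       + 2 * partial_deriv \<beta> \<Phi> x * (matrix_inv (g x) $ \<gamma> $ \<delta> * g x $ \<alpha> $ \<delta>)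
       - 2 * g x $ \<alpha> $ \<beta> * (matrix_inv (g x) $ \<gamma> $ \<delta> * partial_deriv \<delta> \<Phi> x)
       + matrix_inv (g x) $ \<gamma> $ \<delta> * (partial_deriv \<alpha> (\<lambda>x. g x $ \<beta> $ \<delta>) x + partial_deriv \<beta> (\<lambda>x. g x $ \<alpha> $ \<delta>) x
         - partial_deriv \<delta> (\<lambda>x. g x $ \<alpha> $ \<beta>) x)))"
      by (intro arg_cong[where f = "\<lambda>s. 1 / 2 * s"] sum.cong refl) algebra
    also have "exp (- (2 * \<Phi> x)) * exp (2 * \<Phi> x) = 1"
      by (simp add: exp_minus)
    also have "1 / 2 * (\<Sum>\<delta>\<in>UNIV. 1 *
        (2 * partial_deriv \<alpha> \<Phi> x * (matrix_inv (g x) $ \<gamma> $ \<delta> * g x $ \<beta> $ \<delta>)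
       + 2 * partial_deriv \<beta> \<Phi> x * (matrix_inv (g x) $ \<gamma> $ \<delta> * g x $ \<alpha> $ \<delta>)
       - 2 * g x $ \<alpha> $ \<beta> * (matrix_inv (g x) $ \<gamma> $ \<delta> * partial_deriv \<delta> \<Phi> x)
       + matrix_inv (g x) $ \<gamma> $ \<delta> * (partial_deriv \<alpha> (\<lambda>x. g x $ \<beta> $ \<delta>) x + partial_deriv \<beta> (\<lambda>x. g x $ \<alpha> $ \<delta>) x
         - partial_deriv \<delta> (\<lambda>x. g x $ \<alpha> $ \<beta>) x))) = 
      partial_deriv \<alpha> \<Phi> x * (\<Sum>\<delta>\<in>UNIV. matrix_inv (g x) $ \<gamma> $ \<delta> * g x $ \<beta> $ \<delta>)
       + partial_deriv \<beta> \<Phi> x * (\<Sum>\<delta>\<in>UNIV. matrix_inv (g x) $ \<gamma> $ \<delta> * g x $ \<alpha> $ \<delta>)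
       - g x $ \<alpha> $ \<beta> * grad \<gamma> x + christoffel g \<gamma> \<alpha> \<beta> x"
      unfolding christoffel_def[of g] sum.distrib sum_subtractf mult_1 mult.assoc sum_distrib_left[symmetric]
      by (simp only: mult.assoc halves)
    also have "\<dots> = base_christoffel \<gamma> \<alpha> \<beta> x"
      unfolding inverse_mult(2)[OF x] base_christoffel_def by simp
    finally show ?thesis unfolding abc x_def[symmetric] by simp
  next
    fix \<gamma> p q assume abc: "a = Inl \<gamma>" "b = Inr p" "c = Inr q"
    obtain \<alpha> k \<beta> l where pq: "p = (\<alpha>, k)" "q = (\<beta>, l)"
      by (meson surj_pair)
    have "christoffel total_g a b c z = 1 / 2 * (\<Sum>\<delta>\<in>UNIV. (exp (- (2 * \<Phi> x)) * matrix_inv (g x) $ \<gamma> $ \<delta>) *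
       (- (if k = l then e k * partial_deriv \<delta> (\<lambda>x. g x $ \<alpha> $ \<beta>) x else 0)))"
      unfolding abc pq simps by simp
    also have "\<dots> = (if k = l then fibre_christoffel k \<gamma> \<alpha> \<beta> x else 0)"
      unfolding fibre_christoffel_def christoffel_g[OF x] by (simp add: sum_distrib_left sum_negf ac_simps)
    finally show ?thesis unfolding abc pq x_def[symmetric] by simp
  next
    fix r \<alpha> q assume abc: "a = Inr r" "b = Inl \<alpha>" "c = Inr q"
    obtain \<gamma> k \<beta> l where rq: "r = (\<gamma>, k)" "q = (\<beta>, l)"
      by (meson surj_pair)
    have "christoffel total_g a b c z = (if k = l then christoffel g \<gamma> \<alpha> \<beta> x else 0)"
      unfolding mixed[symmetric] abc rq simps by (simp add: eq_commute[of l])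
    then show ?thesis unfolding abc rq x_def[symmetric] by simp
  next
    fix r p \<beta> assume abc: "a = Inr r" "b = Inr p" "c = Inl \<beta>"
    obtain \<gamma> k \<alpha> l where rp: "r = (\<gamma>, k)" "p = (\<alpha>, l)"
      by (meson surj_pair)
    have "christoffel total_g a b c z = (if k = l then christoffel g \<gamma> \<beta> \<alpha> x else 0)"
      unfolding mixed[symmetric] abc rp simps by (simp add: eq_commute[of l])
    then show ?thesis unfolding abc rp x_def[symmetric] by (simp add: christoffel_sym[OF x, of _ \<beta>])
  next
    fix r \<alpha> \<beta> assume abc: "a = Inr r" "b = Inl \<alpha>" "c = Inl \<beta>"
    then show ?thesis unfolding abc simps by (cases r) simp
  qed (auto simp: simps split_paired_all)
qed

lemma partial_deriv_christoffel_total: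
  assumes z: "base_point z \<in> U"
  shows "partial_deriv (Inr p) (christoffel total_g a b c) z = 0" (is ?fib)
    and "partial_deriv (Inl \<delta>) (christoffel total_g a b c) z = block_christoffel (\<lambda>\<gamma> \<alpha> \<beta>. partial_deriv \<delta> (base_christoffel \<gamma> \<alpha> \<beta>) (base_point z))
     (\<lambda>k \<gamma> \<alpha> \<beta>. partial_deriv \<delta> (fibre_christoffel k \<gamma> \<alpha> \<beta>) (base_point z))
     (\<lambda>\<gamma> \<alpha> \<beta>. partial_deriv \<delta> (christoffel g \<gamma> \<alpha> \<beta>) (base_point z)) a b c" (is ?base)
proof -
  let ?B = "\<lambda>x. block_christoffel (\<lambda>\<gamma> \<alpha> \<beta>. base_christoffel \<gamma> \<alpha> \<beta> x) (\<lambda>k \<gamma> \<alpha> \<beta>. fibre_christoffel k \<gamma> \<alpha> \<beta> x)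
    (\<lambda>\<gamma> \<alpha> \<beta>. christoffel g \<gamma> \<alpha> \<beta> x) a b c"
  have *: "partial_deriv i (christoffel total_g a b c) z = partial_deriv i (\<lambda>z. ?B (base_point z)) z" for i
    by (rule partial_deriv_cong[OF open_cylinder[OF open_U]])
       (use z in \<open>simp_all add: cylinder_def christoffel_total\<close>)
  show ?fib unfolding * by (rule partial_deriv_base_point)
  show ?base unfolding * partial_deriv_base_point(1)[of \<delta> ?B]
    by (cases a; cases b; cases c) (auto simp: split_paired_all)
qed

lemma ricci_total_mixed:
  assumes z: "base_point z \<in> U"
  shows "ricci total_g (Inl \<alpha>) (Inr q) z = 0" "ricci total_g (Inr q) (Inl \<alpha>) z = 0"
  by (cases q; simp add: ricci_def riemann_def sum_total christoffel_total[OF z] partial_deriv_christoffel_total[OF z])+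

text \<open>
  The index placement in which the Ricci tensor produces the sum.
\<close>

definition "christoffel_square' \<alpha> \<beta> x = (\<Sum>\<gamma>\<in>UNIV. \<Sum>\<delta>\<in>UNIV. christoffel g \<gamma> \<alpha> \<delta> x * christoffel g \<delta> \<gamma> \<beta> x)"

lemma christoffel_square': "x \<in> U \<Longrightarrow> christoffel_square' \<alpha> \<beta> x = christoffel_square \<alpha> \<beta> x"
  unfolding christoffel_square'_def christoffel_square_def by (simp add: christoffel_sym[of x _ \<alpha>])

text \<open>
  The trace is the logarithmic derivative of \<open>sqrt (det (exp (2 \<Phi>) g)) = const * exp (2 \<Phi>)\<close>.
\<close>

lemma base_christoffel_trace:
  assumes x: "x \<in> U"
  shows "(\<Sum>\<gamma>\<in>UNIV. base_christoffel \<gamma> \<gamma> \<beta> x) = 2 * partial_deriv \<beta> \<Phi> x"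
proof -
  have "(\<Sum>\<delta>\<in>UNIV. g x $ \<delta> $ \<beta> * grad \<delta> x) = partial_deriv \<beta> \<Phi> x"
  proof -
    have "(\<Sum>\<delta>\<in>UNIV. g x $ \<delta> $ \<beta> * grad \<delta> x)
        = (\<Sum>\<delta>\<in>UNIV. (\<Sum>\<gamma>\<in>UNIV. g x $ \<beta> $ \<gamma> * matrix_inv (g x) $ \<gamma> $ \<delta>) * partial_deriv \<delta> \<Phi> x)"
      unfolding sum_2 sym_g[OF x, of _ \<beta>] by algebra
    also have "\<dots> = partial_deriv \<beta> \<Phi> x"
      unfolding inverse_mult(1)[OF x] by (simp add: if_distrib[of "\<lambda>t. t * _"] cong: if_cong)
    finally show ?thesis .
  qed
  then show ?thesis
    unfolding base_christoffel_def using christoffel_trace[OF x, of \<beta>]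
    by (simp add: sum.distrib sum_subtractf)
qed

lemma smooth_grad: "smooth_on U (grad \<gamma>)"
proof -
  have v: "grad \<gamma> = (\<lambda>x. matrix_inv (g x) $ \<gamma> $ 1 * partial_deriv 1 \<Phi> x + matrix_inv (g x) $ \<gamma> $ 2 * partial_deriv 2 \<Phi> x)"
    by (simp add: sum_2)
  show ?thesis unfolding v
    by (intro smooth_on_add smooth_on_mult smooth_inverse_g smooth_on_partial_deriv smooth_\<Phi> open_U)
qed

lemma smooth_base_christoffel: "smooth_on U (base_christoffel \<gamma> \<alpha> \<beta>)"
proof -
  have i: "smooth_on U (\<lambda>x. if b then partial_deriv \<delta> \<Phi> x else 0)" for b \<delta>
    by (cases b) (simp_all add: smooth_on_partial_deriv smooth_\<Phi>)
  have c: "base_christoffel \<gamma> \<alpha> \<beta> = (\<lambda>x. christoffel g \<gamma> \<alpha> \<beta> x + (if \<gamma> = \<beta> then partial_deriv \<alpha> \<Phi> x else 0)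
     + (if \<gamma> = \<alpha> then partial_deriv \<beta> \<Phi> x else 0) - g x $ \<alpha> $ \<beta> * grad \<gamma> x)"
    by (rule ext) (simp add: base_christoffel_def)
  show ?thesis
    unfolding c
    by (intro smooth_on_diff smooth_on_add smooth_on_mult smooth_christoffel i smooth_g smooth_grad open_U)
qed

lemma partial_deriv_sum_2:
  assumes "\<And>\<gamma>. f \<gamma> differentiable (at x)"
  shows "partial_deriv i (\<lambda>x. \<Sum>\<gamma>\<in>(UNIV::2 set). f \<gamma> x) x = (\<Sum>\<gamma>\<in>UNIV. partial_deriv i (f \<gamma>) x)"
  using assms by (simp add: sum_2)

lemma base_christoffel_trace_deriv:
  assumes x: "x \<in> U"
  shows "(\<Sum>\<gamma>\<in>UNIV. partial_deriv \<alpha> (base_christoffel \<gamma> \<gamma> \<beta>) x) = 2 * partial_deriv \<alpha> (partial_deriv \<beta> \<Phi>) x"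
proof -
  have "(\<Sum>\<gamma>\<in>UNIV. partial_deriv \<alpha> (base_christoffel \<gamma> \<gamma> \<beta>) x) = partial_deriv \<alpha> (\<lambda>x. \<Sum>\<gamma>\<in>UNIV. base_christoffel \<gamma> \<gamma> \<beta> x) x"
    by (rule partial_deriv_sum_2[symmetric]) (rule smooth_on_differentiable[OF smooth_base_christoffel x])
  also have "\<dots> = partial_deriv \<alpha> (\<lambda>x. 2 * partial_deriv \<beta> \<Phi> x) x"
    by (rule partial_deriv_cong[OF open_U x]) (rule base_christoffel_trace)
  finally show ?thesis
    using smooth_on_differentiable[OF smooth_on_partial_deriv[OF smooth_\<Phi>] x] by simp
qed

lemma christoffel_trace_deriv:
  assumes x: "x \<in> U"
  shows "(\<Sum>\<gamma>\<in>UNIV. partial_deriv \<alpha> (christoffel g \<gamma> \<gamma> \<beta>) x) = 0"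
proof -
  have "(\<Sum>\<gamma>\<in>UNIV. partial_deriv \<alpha> (christoffel g \<gamma> \<gamma> \<beta>) x) = partial_deriv \<alpha> (\<lambda>x. \<Sum>\<gamma>\<in>UNIV. christoffel g \<gamma> \<gamma> \<beta> x) x"
    by (rule partial_deriv_sum_2[symmetric]) (rule smooth_on_differentiable[OF smooth_christoffel x])
  also have "\<dots> = partial_deriv \<alpha> (\<lambda>x. 0) x"
    by (rule partial_deriv_cong[OF open_U x]) (rule christoffel_trace)
  finally show ?thesis by simp
qed

lemma base_christoffel_div:
  assumes x: "x \<in> U"
  shows "(\<Sum>\<gamma>\<in>UNIV. partial_deriv \<gamma> (base_christoffel \<gamma> \<alpha> \<beta>) x) = 2 * christoffel_square \<alpha> \<beta> x
    + 2 * partial_deriv \<alpha> (partial_deriv \<beta> \<Phi>) x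
    - (\<Sum>\<gamma>\<in>UNIV. partial_deriv \<gamma> (\<lambda>y. g y $ \<alpha> $ \<beta>) x * grad \<gamma> x) - g x $ \<alpha> $ \<beta> * laplacian \<Phi> x"
proof -
  have [simp]: "partial_deriv \<delta> \<Phi> differentiable (at x)" for \<delta>
    by (rule smooth_on_differentiable[OF smooth_on_partial_deriv[OF smooth_\<Phi>] x])
  have dV: "(\<lambda>x. grad \<delta> x) differentiable (at x)" for \<delta>
    by (rule smooth_on_differentiable[OF smooth_grad x])
  have dK: "christoffel g \<gamma> \<alpha> \<beta> differentiable (at x)" for \<gamma>
    by (rule smooth_on_differentiable[OF smooth_christoffel x])
  have gen: "partial_deriv \<gamma> (\<lambda>x. a x + b x + c x - h x * w x) x
      = partial_deriv \<gamma> a x + partial_deriv \<gamma> b x + partial_deriv \<gamma> c x - (h x * partial_deriv \<gamma> w x + partial_deriv \<gamma> h x * w x)"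
    if "a differentiable (at x)" "b differentiable (at x)" "c differentiable (at x)" "h differentiable (at x)" "w differentiable (at x)"
    for a b c h w :: "real ^ 2 \<Rightarrow> real" and \<gamma>
    using that by simp
  have i: "(\<lambda>x. if b then partial_deriv \<delta> \<Phi> x else 0) differentiable (at x)"
     "partial_deriv \<gamma> (\<lambda>x. if b then partial_deriv \<delta> \<Phi> x else 0) x = (if b then partial_deriv \<gamma> (partial_deriv \<delta> \<Phi>) x else 0)"
    for b \<delta> \<gamma> by (cases b; simp)+
  have c: "base_christoffel \<gamma> \<alpha> \<beta> = (\<lambda>x. christoffel g \<gamma> \<alpha> \<beta> x + (if \<gamma> = \<beta> then partial_deriv \<alpha> \<Phi> x else 0)
     + (if \<gamma> = \<alpha> then partial_deriv \<beta> \<Phi> x else 0) - g x $ \<alpha> $ \<beta> * grad \<gamma> x)" for \<gamma>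
    by (rule ext) (simp add: base_christoffel_def)
  have "partial_deriv \<gamma> (base_christoffel \<gamma> \<alpha> \<beta>) x = partial_deriv \<gamma> (christoffel g \<gamma> \<alpha> \<beta>) x
    + (if \<gamma> = \<beta> then partial_deriv \<gamma> (partial_deriv \<alpha> \<Phi>) x else 0)
    + (if \<gamma> = \<alpha> then partial_deriv \<gamma> (partial_deriv \<beta> \<Phi>) x else 0)
    - (g x $ \<alpha> $ \<beta> * partial_deriv \<gamma> (grad \<gamma>) x + partial_deriv \<gamma> (\<lambda>y. g y $ \<alpha> $ \<beta>) x * grad \<gamma> x)" for \<gamma>
    unfolding c using x by (subst gen) (simp_all only: i differentiable_g dV dK simp_thms)
  then have "(\<Sum>\<gamma>\<in>UNIV. partial_deriv \<gamma> (base_christoffel \<gamma> \<alpha> \<beta>) x) = (\<Sum>\<gamma>\<in>UNIV. partial_deriv \<gamma> (christoffel g \<gamma> \<alpha> \<beta>) x)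
    + partial_deriv \<beta> (partial_deriv \<alpha> \<Phi>) x + partial_deriv \<alpha> (partial_deriv \<beta> \<Phi>) x
    - g x $ \<alpha> $ \<beta> * (\<Sum>\<gamma>\<in>UNIV. partial_deriv \<gamma> (grad \<gamma>) x) - (\<Sum>\<gamma>\<in>UNIV. partial_deriv \<gamma> (\<lambda>y. g y $ \<alpha> $ \<beta>) x * grad \<gamma> x)"
    by (simp add: sum.distrib sum_subtractf sum_distrib_left)
  then show ?thesis
    unfolding div_christoffel[OF x] div_grad[OF x smooth_\<Phi>]
    using partial_deriv_commute[OF open_U smooth_\<Phi> x, of \<alpha> \<beta>] by simp
qed

lemma base_christoffel_quadratic:
  assumes x: "x \<in> U"
  shows "(\<Sum>\<gamma>\<in>UNIV. \<Sum>\<delta>\<in>UNIV. base_christoffel \<gamma> \<gamma> \<delta> x * base_christoffel \<delta> \<beta> \<alpha> x - base_christoffel \<gamma> \<beta> \<delta> x * base_christoffel \<delta> \<gamma> \<alpha> x)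
    = (\<Sum>\<gamma>\<in>UNIV. partial_deriv \<gamma> (\<lambda>y. g y $ \<beta> $ \<alpha>) x * grad \<gamma> x) - christoffel_square' \<beta> \<alpha> x"
proof -
  have low: "2 * (\<Sum>\<delta>\<in>UNIV. g x $ \<gamma> $ \<delta> * christoffel g \<delta> \<beta> \<alpha> x) = partial_deriv \<gamma> (\<lambda>y. g y $ \<beta> $ \<alpha>) x" for \<gamma> \<alpha> \<beta>
    unfolding lower_christoffel[OF x, of \<alpha> \<gamma> \<beta>, symmetric] 
    using codazzi[OF x, of \<gamma> \<alpha> \<beta>] partial_deriv_g_sym[OF x, of \<gamma> \<beta> \<alpha>] partial_deriv_g_sym[OF x] by simp
  show ?thesis
    unfolding low[symmetric] christoffel_square'_def
  proof (rule conformal_algebra)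
    show "christoffel g \<gamma> \<alpha> \<beta> x = christoffel g \<gamma> \<beta> \<alpha> x" for \<gamma> \<alpha> \<beta>
      by (rule christoffel_sym[OF x])
    show "(\<Sum>\<gamma>\<in>UNIV. christoffel g \<gamma> \<gamma> \<beta> x) = 0" for \<beta>
      by (rule christoffel_trace[OF x])
    show "g x $ \<alpha> $ \<beta> = g x $ \<beta> $ \<alpha>" for \<alpha> \<beta>
      by (rule sym_g[OF x])
    show "(\<Sum>\<delta>\<in>UNIV. g x $ \<alpha> $ \<delta> * christoffel g \<delta> \<beta> \<gamma> x) = (\<Sum>\<delta>\<in>UNIV. g x $ \<beta> $ \<delta> * christoffel g \<delta> \<alpha> \<gamma> x)" for \<alpha> \<beta> \<gamma>
      using low[of \<alpha> \<beta> \<gamma>] low[of \<beta> \<alpha> \<gamma>] codazzi[OF x, of \<alpha> \<beta> \<gamma>] by simp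
    show "partial_deriv \<gamma> \<Phi> x = (\<Sum>\<delta>\<in>UNIV. g x $ \<gamma> $ \<delta> * grad \<delta> x)" for \<gamma>
    proof -
      have "(\<Sum>\<delta>\<in>UNIV. g x $ \<gamma> $ \<delta> * grad \<delta> x)
        = (\<Sum>\<delta>\<in>UNIV. (\<Sum>\<beta>\<in>UNIV. g x $ \<gamma> $ \<beta> * matrix_inv (g x) $ \<beta> $ \<delta>) * partial_deriv \<delta> \<Phi> x)"
        unfolding sum_2 by algebra
      also have "\<dots> = partial_deriv \<gamma> \<Phi> x"
        unfolding inverse_mult(1)[OF x] by (simp add: if_distrib[of "\<lambda>t. t * _"] cong: if_cong)
      finally show ?thesis by simp
    qed
  qed (rule base_christoffel_def)
qed

text \<open>
  Each of the \<open>CARD('n)\<close> fibre blocks, having constant determinant, contributes only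
  \<open>- 1/4 tr (g\<^sup>-\<^sup>1 \<partial>\<^sub>\<alpha> g g\<^sup>-\<^sup>1 \<partial>\<^sub>\<beta> g)\<close>. The rest is the Ricci tensor of the conformal metric on the base,
  namely that of \<open>g\<close> diminished by \<open>(\<Delta> \<Phi>) g\<close>.
\<close>

lemma ricci_total_base:
  assumes z: "base_point z \<in> U" and "x = base_point z"
  shows "ricci total_g (Inl \<alpha>) (Inl \<beta>) z = (1 - real CARD('n)) * christoffel_square \<beta> \<alpha> x - g x $ \<beta> $ \<alpha> * laplacian \<Phi> x"
proof -
  have x: "x \<in> U" using assms by simp
  have t: "(\<Sum>\<gamma>\<in>UNIV. \<Sum>\<delta>\<in>UNIV. christoffel g \<gamma> \<gamma> \<delta> x * base_christoffel \<delta> \<beta> \<alpha> x) = 0"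
    by (subst sum.swap) (simp add: sum_distrib_right[symmetric] christoffel_trace[OF x])
  have "ricci total_g (Inl \<alpha>) (Inl \<beta>) z =
     (\<Sum>\<gamma>\<in>UNIV. partial_deriv \<gamma> (base_christoffel \<gamma> \<beta> \<alpha>) x) - (\<Sum>\<gamma>\<in>UNIV. partial_deriv \<beta> (base_christoffel \<gamma> \<gamma> \<alpha>) x)
     + (\<Sum>\<gamma>\<in>UNIV. \<Sum>\<delta>\<in>UNIV. base_christoffel \<gamma> \<gamma> \<delta> x * base_christoffel \<delta> \<beta> \<alpha> x - base_christoffel \<gamma> \<beta> \<delta> x * base_christoffel \<delta> \<gamma> \<alpha> x)
     + real CARD('n) * (- (\<Sum>\<gamma>\<in>UNIV. partial_deriv \<beta> (christoffel g \<gamma> \<gamma> \<alpha>) x)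
       + (\<Sum>\<gamma>\<in>UNIV. \<Sum>\<delta>\<in>UNIV. christoffel g \<gamma> \<gamma> \<delta> x * base_christoffel \<delta> \<beta> \<alpha> x) - christoffel_square' \<beta> \<alpha> x)"
    unfolding ricci_def riemann_def sum_total christoffel_total[OF z] partial_deriv_christoffel_total[OF z] assms(2)[symmetric]
    by (simp add: sum.distrib sum_subtractf sum_negf sum_fibre christoffel_square'_def right_diff_distrib)
  also have "\<dots> = (1 - real CARD('n)) * christoffel_square \<beta> \<alpha> x - g x $ \<beta> $ \<alpha> * laplacian \<Phi> x"
    unfolding base_christoffel_div[OF x] base_christoffel_trace_deriv[OF x] base_christoffel_quadratic[OF x] christoffel_trace_deriv[OF x] t christoffel_square'[OF x]
    by (simp add: algebra_simps)
  finally show ?thesis .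
qed

lemma fibre_christoffel_div:
  assumes x: "x \<in> U"
  shows "(\<Sum>\<gamma>\<in>UNIV. partial_deriv \<gamma> (fibre_christoffel k \<gamma> \<alpha> \<beta>) x)
    = - (e k * exp (- (2 * \<Phi> x)) * (2 * christoffel_square \<alpha> \<beta> x - 2 * (\<Sum>\<gamma>\<in>UNIV. partial_deriv \<gamma> \<Phi> x * christoffel g \<gamma> \<alpha> \<beta> x)))"
proof -
  have d: "\<Phi> differentiable (at x)" "christoffel g \<gamma> \<alpha> \<beta> differentiable (at x)" for \<gamma>
    by (rule smooth_on_differentiable[OF smooth_\<Phi> x] smooth_on_differentiable[OF smooth_christoffel x])+
  have "fibre_christoffel k \<gamma> \<alpha> \<beta> = (\<lambda>x. - (e k * exp (- (2 * \<Phi> x)) * christoffel g \<gamma> \<alpha> \<beta> x))" for \<gamma>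
    by (rule ext) (simp add: fibre_christoffel_def)
  then have "partial_deriv \<gamma> (fibre_christoffel k \<gamma> \<alpha> \<beta>) x = - (e k * exp (- (2 * \<Phi> x)) *
      (partial_deriv \<gamma> (christoffel g \<gamma> \<alpha> \<beta>) x - 2 * (partial_deriv \<gamma> \<Phi> x * christoffel g \<gamma> \<alpha> \<beta> x)))" for \<gamma>
    using d by (simp add: algebra_simps)
  then show ?thesis
    unfolding div_christoffel[OF x, symmetric] by (simp only: sum_negf sum_distrib_left[symmetric] sum_subtractf)
qed

text \<open>
  The conformal factor drops out, since in dimension two the trace of the base Christoffel symbols
  offsets the derivative of \<open>exp (- 2 \<Phi>)\<close>; what remains is the sigma model equation of
  \<open>div_christoffel\<close>.
\<close>

lemma ricci_total_fibre:
  assumes z: "base_point z \<in> U"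
  shows "ricci total_g (Inr p) (Inr q) z = 0"
proof -
  define x where "x = base_point z"
  have x: "x \<in> U" using z by (simp add: x_def)
  obtain \<alpha> k \<beta> l where pq: "p = (\<alpha>, k)" "q = (\<beta>, l)"
    by (meson surj_pair)
  have a: "(\<Sum>\<gamma>\<in>UNIV. \<Sum>\<delta>\<in>UNIV. base_christoffel \<gamma> \<gamma> \<delta> x * fibre_christoffel l \<delta> \<beta> \<alpha> x)
    = - (e l * exp (- (2 * \<Phi> x)) * (2 * (\<Sum>\<gamma>\<in>UNIV. partial_deriv \<gamma> \<Phi> x * christoffel g \<gamma> \<beta> \<alpha> x)))"
    by (subst sum.swap, simp only: sum_distrib_right[symmetric] base_christoffel_trace[OF x])
       (simp add: fibre_christoffel_def sum_distrib_left sum_negf ac_simps)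
  have b: "(\<Sum>\<gamma>\<in>UNIV. \<Sum>\<delta>\<in>UNIV. christoffel g \<gamma> \<gamma> \<delta> x * fibre_christoffel l \<delta> \<beta> \<alpha> x) = 0"
    by (subst sum.swap) (simp add: sum_distrib_right[symmetric] christoffel_trace[OF x])
  have c: "(\<Sum>\<gamma>\<in>UNIV. \<Sum>\<delta>\<in>UNIV. fibre_christoffel l \<gamma> \<beta> \<delta> x * christoffel g \<delta> \<gamma> \<alpha> x) = - (e l * exp (- (2 * \<Phi> x)) * christoffel_square \<beta> \<alpha> x)"
    unfolding christoffel_square'[OF x, symmetric] by (simp add: fibre_christoffel_def christoffel_square'_def sum_distrib_left sum_negf ac_simps)
  have d: "(\<Sum>\<gamma>\<in>UNIV. \<Sum>\<delta>\<in>UNIV. christoffel g \<gamma> \<beta> \<delta> x * fibre_christoffel l \<delta> \<gamma> \<alpha> x) = - (e l * exp (- (2 * \<Phi> x)) * christoffel_square \<beta> \<alpha> x)"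
    unfolding christoffel_square'[OF x, symmetric] by (simp add: fibre_christoffel_def christoffel_square'_def sum_distrib_left sum_negf ac_simps)
  have "ricci total_g (Inr p) (Inr q) z = (if l = k then
      (\<Sum>\<gamma>\<in>UNIV. partial_deriv \<gamma> (fibre_christoffel l \<gamma> \<beta> \<alpha>) x)
       + (\<Sum>\<gamma>\<in>UNIV. \<Sum>\<delta>\<in>UNIV. base_christoffel \<gamma> \<gamma> \<delta> x * fibre_christoffel l \<delta> \<beta> \<alpha> x)
       + real CARD('n) * (\<Sum>\<gamma>\<in>UNIV. \<Sum>\<delta>\<in>UNIV. christoffel g \<gamma> \<gamma> \<delta> x * fibre_christoffel l \<delta> \<beta> \<alpha> x)
       - (\<Sum>\<gamma>\<in>UNIV. \<Sum>\<delta>\<in>UNIV. fibre_christoffel l \<gamma> \<beta> \<delta> x * christoffel g \<delta> \<gamma> \<alpha> x)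
       - (\<Sum>\<gamma>\<in>UNIV. \<Sum>\<delta>\<in>UNIV. christoffel g \<gamma> \<beta> \<delta> x * fibre_christoffel l \<delta> \<gamma> \<alpha> x) else 0)"
    unfolding ricci_def riemann_def sum_total christoffel_total[OF z] partial_deriv_christoffel_total[OF z] x_def[symmetric] pq
    by (simp add: sum.distrib sum_subtractf sum_negf sum_fibre sum_fibre_product)
  also have "\<dots> = 0"
    unfolding fibre_christoffel_div[OF x] a b c d by (simp add: algebra_simps)
  finally show ?thesis .
qed

lemma ricci_flat_total:
  assumes "\<And>x \<alpha> \<beta>. x \<in> U \<Longrightarrow> (1 - real CARD('n)) * christoffel_square \<alpha> \<beta> x = g x $ \<alpha> $ \<beta> * laplacian \<Phi> x"
  shows "ricci_flat_on (cylinder U) total_g"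
  unfolding ricci_flat_on_def
proof (intro ballI allI)
  fix z :: "real ^ (2 + 2 \<times> 'n)" and i j assume "z \<in> cylinder U"
  then have z: "base_point z \<in> U" by (simp add: cylinder_def)
  show "ricci total_g i j z = 0"
    by (cases i; cases j)
       (simp_all add: ricci_total_mixed[OF z] ricci_total_fibre[OF z] ricci_total_base[OF z refl] assms[OF z])
qed

end
end

section \<open>Minimal graphs\<close>

text \<open>
  The Codazzi defect of \<open>h/\<surd>\<rho>\<close>, cleared of denominators, is a multiple of the minimal surface
  operator: the difference of the two sides is \<open>\<epsilon> (b p - a q)\<close>, respectively
  \<open>\<epsilon> (b q - c p)\<close>, times the left side of \<open>min\<close>.
\<close>

lemma minimal_codazzi_algebra:
  fixes a b c p q r s t \<epsilon> :: real
  defines "h11 \<equiv> a + \<epsilon> * p * p" and "h12 \<equiv> b + \<epsilon> * p * q" and "h22 \<equiv> c + \<epsilon> * q * q"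
  assumes min: "h22 * r - 2 * h12 * s + h11 * t = 0"
    and \<rho>: "d * \<rho> = h11 * h22 - h12 * h12" and d: "d = a * c - b * b"
  shows "d * \<rho> * (2 * \<epsilon> * p * s - \<epsilon> * (r * q + p * s))
     = \<epsilon> * (h11 * (c * p * s - b * (s * q + p * t) + a * q * t)
           - h12 * (c * p * r - b * (r * q + p * s) + a * q * s))"
    and "d * \<rho> * (2 * \<epsilon> * q * s - \<epsilon> * (s * q + p * t))
     = \<epsilon> * (h22 * (c * p * r - b * (r * q + p * s) + a * q * s)
           - h12 * (c * p * s - b * (s * q + p * t) + a * q * t))"
proof -
  show "d * \<rho> * (2 * \<epsilon> * p * s - \<epsilon> * (r * q + p * s))
     = \<epsilon> * (h11 * (c * p * s - b * (s * q + p * t) + a * q * t)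
           - h12 * (c * p * r - b * (r * q + p * s) + a * q * s))"
    using min \<rho> d unfolding h11_def h12_def h22_def by algebra
  show "d * \<rho> * (2 * \<epsilon> * q * s - \<epsilon> * (s * q + p * t))
     = \<epsilon> * (h22 * (c * p * r - b * (r * q + p * s) + a * q * s)
           - h12 * (c * p * s - b * (s * q + p * t) + a * q * t))"
    using min \<rho> d unfolding h11_def h12_def h22_def by algebra
qed

locale minimal_graph =
  fixes \<epsilon> :: real and g0 :: "real ^ 2 ^ 2" and U :: "(real ^ 2) set" and \<phi> :: "real ^ 2 \<Rightarrow> real"
  assumes sym0: "transpose g0 = g0" and inv0: "invertible g0"
    and open_U: "open U" and smooth_\<phi>: "smooth_on U \<phi>"
    and minimal: "minimal_graph_on U \<epsilon> g0 \<phi>"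
    and \<rho>_pos: "x \<in> U \<Longrightarrow> graph_rho \<epsilon> g0 \<phi> x > 0"
begin

abbreviation "\<rho> \<equiv> graph_rho \<epsilon> g0 \<phi>"
abbreviation "h \<equiv> graph_metric \<epsilon> g0 \<phi>"
abbreviation "g \<equiv> conformal_graph_metric \<epsilon> g0 \<phi>"
definition "det_g0 = g0 $ 1 $ 1 * g0 $ 2 $ 2 - g0 $ 1 $ 2 * g0 $ 1 $ 2"

lemma g0_21: "g0 $ 2 $ 1 = g0 $ 1 $ 2"
proof -
  have "transpose g0 $ 1 $ 2 = g0 $ 1 $ 2" by (simp only: sym0)
  then show ?thesis by (simp add: transpose_def)
qed

lemma det_g0_nz: "det_g0 \<noteq> 0"
  using inv0 unfolding invertible_det_nz det_2 det_g0_def g0_21 .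

lemma \<rho>_eq: "\<rho> x = 1 + \<epsilon> / det_g0 * (g0 $ 2 $ 2 * (partial_deriv 1 \<phi> x * partial_deriv 1 \<phi> x)
    - 2 * g0 $ 1 $ 2 * (partial_deriv 1 \<phi> x * partial_deriv 2 \<phi> x)
    + g0 $ 1 $ 1 * (partial_deriv 2 \<phi> x * partial_deriv 2 \<phi> x))"
proof -
  have d: "det_g0 = g0 $ 1 $ 1 * g0 $ 2 $ 2 - g0 $ 1 $ 2 * g0 $ 2 $ 1" by (simp add: det_g0_def g0_21)
  show ?thesis
    unfolding graph_rho_def sum_2 matrix_inv_2[OF d det_g0_nz] g0_21
    by (simp only: divide_inverse) algebra
qed

lemma h_eq: "h x $ \<alpha> $ \<beta> = g0 $ \<alpha> $ \<beta> + \<epsilon> * partial_deriv \<alpha> \<phi> x * partial_deriv \<beta> \<phi> x"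
  by (simp add: graph_metric_def)

lemma h_sym: "h x $ \<alpha> $ \<beta> = h x $ \<beta> $ \<alpha>"
  using exhaust_2[of \<alpha>] exhaust_2[of \<beta>] by (auto simp: h_eq g0_21)

lemma det_h: "h x $ 1 $ 1 * h x $ 2 $ 2 - h x $ 1 $ 2 * h x $ 1 $ 2 = det_g0 * \<rho> x"
proof -
  have "det_g0 * \<rho> x = det_g0 + (det_g0 / det_g0) * \<epsilon> * (g0 $ 2 $ 2 * (partial_deriv 1 \<phi> x * partial_deriv 1 \<phi> x)
    - 2 * g0 $ 1 $ 2 * (partial_deriv 1 \<phi> x * partial_deriv 2 \<phi> x)
    + g0 $ 1 $ 1 * (partial_deriv 2 \<phi> x * partial_deriv 2 \<phi> x))"
    unfolding \<rho>_eq by (simp only: divide_inverse) algebra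
  also have "det_g0 / det_g0 = 1" using det_g0_nz by simp
  finally show ?thesis unfolding h_eq det_g0_def by algebra
qed

lemma smooth_h: "smooth_on U (\<lambda>x. h x $ \<alpha> $ \<beta>)"
  unfolding h_eq
  by (intro smooth_on_add smooth_on_mult smooth_on_const smooth_on_partial_deriv smooth_\<phi> open_U)

lemma smooth_\<rho>: "smooth_on U \<rho>"
  unfolding \<rho>_eq[abs_def]
  by (intro smooth_on_add smooth_on_diff smooth_on_mult smooth_on_const smooth_on_partial_deriv smooth_\<phi> open_U)

text \<open>
  The factor \<open>1/\<surd>\<rho>\<close>, in a form to which the closure properties of smooth functions apply.
\<close>

definition "\<sigma> x = exp (- (1 / 2) * ln (\<rho> x))"

lemma smooth_\<sigma>: "smooth_on U \<sigma>"
  unfolding \<sigma>_def[abs_def]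
  by (intro smooth_on_exp smooth_on_mult smooth_on_const smooth_on_ln smooth_\<rho> open_U \<rho>_pos)

lemma g_eq: "x \<in> U \<Longrightarrow> g x $ \<alpha> $ \<beta> = \<sigma> x * h x $ \<alpha> $ \<beta>"
proof -
  assume "x \<in> U"
  then have p: "\<rho> x > 0" by (rule \<rho>_pos)
  have "\<sigma> x = inverse (exp (ln (sqrt (\<rho> x))))"
    using p unfolding \<sigma>_def exp_minus[symmetric] by (simp add: ln_sqrt)
  also have "\<dots> = 1 / sqrt (\<rho> x)" using p by (simp add: divide_inverse)
  finally show ?thesis by (simp add: conformal_graph_metric_def)
qed

lemma \<sigma>_sq: "x \<in> U \<Longrightarrow> \<sigma> x * \<sigma> x * \<rho> x = 1"
proof -
  assume x: "x \<in> U"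
  have "\<sigma> x * \<sigma> x = exp (- ln (\<rho> x))"
    unfolding \<sigma>_def exp_add[symmetric] by simp
  then show ?thesis using \<rho>_pos[OF x] by (simp add: exp_minus)
qed

lemma minimal_eq:
  assumes x: "x \<in> U"
  shows "h x $ 2 $ 2 * partial_deriv 1 (partial_deriv 1 \<phi>) x - 2 * h x $ 1 $ 2 * partial_deriv 1 (partial_deriv 2 \<phi>) x
    + h x $ 1 $ 1 * partial_deriv 2 (partial_deriv 2 \<phi>) x = 0"
proof -
  have d: "det_g0 * \<rho> x = h x $ 1 $ 1 * h x $ 2 $ 2 - h x $ 1 $ 2 * h x $ 2 $ 1"
    using det_h[of x] h_sym[of x 2 1] by simp
  have nz: "det_g0 * \<rho> x \<noteq> 0" using det_g0_nz \<rho>_pos[OF x] by simp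
  have "(\<Sum>\<mu>\<in>UNIV. \<Sum>\<nu>\<in>UNIV. matrix_inv (h x) $ \<mu> $ \<nu> * partial_deriv \<nu> (partial_deriv \<mu> \<phi>) x) = 0"
    using minimal \<rho>_pos[OF x] x unfolding minimal_graph_on_def mean_curvature_def by force
  then have "(h x $ 2 $ 2 * partial_deriv 1 (partial_deriv 1 \<phi>) x - 2 * h x $ 1 $ 2 * partial_deriv 1 (partial_deriv 2 \<phi>) x
    + h x $ 1 $ 1 * partial_deriv 2 (partial_deriv 2 \<phi>) x) / (det_g0 * \<rho> x) = 0"
    unfolding sum_2 matrix_inv_2[OF d nz] h_sym[of x 2 1] partial_deriv_commute[OF open_U smooth_\<phi> x, of 2 1]
    by (simp only: divide_inverse) algebra
  then show ?thesis using nz by simp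
qed

text \<open>
  On a minimal graph the coordinates \<open>x\<^sup>1, x\<^sup>2\<close> are harmonic, that is
  \<open>\<partial>\<^sub>\<alpha> g\<^sup>\<alpha>\<^sup>\<beta> = 0\<close>; in dimension two, with constant determinant, these are the Codazzi equations.
\<close>

lemma codazzi_12:
  assumes x: "x \<in> U"
  shows "partial_deriv 2 (\<lambda>y. g y $ 1 $ 1) x = partial_deriv 1 (\<lambda>y. g y $ 1 $ 2) x"
    and "partial_deriv 1 (\<lambda>y. g y $ 2 $ 2) x = partial_deriv 2 (\<lambda>y. g y $ 1 $ 2) x"
proof -
  let ?p = "partial_deriv 1 \<phi> x" and ?q = "partial_deriv 2 \<phi> x"
    and ?\<phi> = "\<lambda>\<alpha> \<beta>. partial_deriv \<alpha> (partial_deriv \<beta> \<phi>) x"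
  have [simp]: "partial_deriv \<alpha> \<phi> differentiable (at x)" for \<alpha>
    by (rule smooth_on_differentiable[OF smooth_on_partial_deriv[OF smooth_\<phi>] x])
  have d\<rho>: "\<rho> differentiable (at x)" "\<sigma> differentiable (at x)" "(\<lambda>x. h x $ \<alpha> $ \<beta>) differentiable (at x)" for \<alpha> \<beta>
    by (rule smooth_on_differentiable[OF _ x] smooth_\<rho> smooth_\<sigma> smooth_h)+
  have \<sigma>': "partial_deriv \<gamma> \<sigma> x = - (1 / 2) * (partial_deriv \<gamma> \<rho> x / \<rho> x) * \<sigma> x" for \<gamma>
  proof -
    have "\<sigma> = (\<lambda>x. exp (- (1 / 2) * ln (\<rho> x)))" by (rule ext) (rule \<sigma>_def)
    then show ?thesis using d\<rho>(1) \<rho>_pos[OF x] by (simp add: mult.commute)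
  qed
  have \<rho>': "partial_deriv \<gamma> \<rho> x = 2 * (\<epsilon> / det_g0 * (g0 $ 2 $ 2 * ?p * ?\<phi> \<gamma> 1 - g0 $ 1 $ 2 * (?\<phi> \<gamma> 1 * ?q + ?p * ?\<phi> \<gamma> 2)
     + g0 $ 1 $ 1 * ?q * ?\<phi> \<gamma> 2))" for \<gamma>
  proof -
    have "\<rho> = (\<lambda>x. 1 + \<epsilon> / det_g0 * (g0 $ 2 $ 2 * (partial_deriv 1 \<phi> x * partial_deriv 1 \<phi> x)
    - 2 * g0 $ 1 $ 2 * (partial_deriv 1 \<phi> x * partial_deriv 2 \<phi> x)
    + g0 $ 1 $ 1 * (partial_deriv 2 \<phi> x * partial_deriv 2 \<phi> x)))"
      by (rule ext) (rule \<rho>_eq)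
    then have "partial_deriv \<gamma> \<rho> x = \<epsilon> / det_g0 * (g0 $ 2 $ 2 * (?p * ?\<phi> \<gamma> 1 + ?\<phi> \<gamma> 1 * ?p)
      - 2 * g0 $ 1 $ 2 * (?p * ?\<phi> \<gamma> 2 + ?\<phi> \<gamma> 1 * ?q) + g0 $ 1 $ 1 * (?q * ?\<phi> \<gamma> 2 + ?\<phi> \<gamma> 2 * ?q))"
      using det_g0_nz by simp
    then show ?thesis by algebra
  qed
  have h': "partial_deriv \<gamma> (\<lambda>x. h x $ \<alpha> $ \<beta>) x
      = \<epsilon> * (?\<phi> \<gamma> \<alpha> * partial_deriv \<beta> \<phi> x + partial_deriv \<alpha> \<phi> x * ?\<phi> \<gamma> \<beta>)" for \<alpha> \<beta> \<gamma>
    unfolding h_eq by (simp add: algebra_simps)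
  have quot: "u * v + - (1 / 2) * (w / r) * u * y = u / (2 * r) * (2 * r * v - y * w)" if "r \<noteq> 0" for u v w r y :: real
    using that by (simp add: field_simps)
  have g': "partial_deriv \<gamma> (\<lambda>x. g x $ \<alpha> $ \<beta>) x
    = \<sigma> x / (2 * \<rho> x) * (2 * \<rho> x * partial_deriv \<gamma> (\<lambda>x. h x $ \<alpha> $ \<beta>) x - h x $ \<alpha> $ \<beta> * partial_deriv \<gamma> \<rho> x)" for \<alpha> \<beta> \<gamma>
  proof -
    have "partial_deriv \<gamma> (\<lambda>x. g x $ \<alpha> $ \<beta>) x = partial_deriv \<gamma> (\<lambda>x. \<sigma> x * h x $ \<alpha> $ \<beta>) x"
      by (rule partial_deriv_cong[OF open_U x]) (rule g_eq)
    also have "\<dots> = \<sigma> x * partial_deriv \<gamma> (\<lambda>x. h x $ \<alpha> $ \<beta>) x + partial_deriv \<gamma> \<sigma> x * h x $ \<alpha> $ \<beta>"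
      by (rule partial_deriv_mult[OF d\<rho>(2,3)])
    finally show ?thesis unfolding \<sigma>' using quot \<rho>_pos[OF x] by simp
  qed
  note c = partial_deriv_commute[OF open_U smooth_\<phi> x, of 2 1]
  note alg = minimal_codazzi_algebra[of "g0 $ 2 $ 2" \<epsilon> ?q "?\<phi> 1 1" "g0 $ 1 $ 2" ?p "?\<phi> 1 2" "g0 $ 1 $ 1" "?\<phi> 2 2" det_g0 "\<rho> x",
    folded h_eq, OF minimal_eq[OF x] det_h[symmetric] det_g0_def]
  have k: "det_g0 * (\<epsilon> / det_g0) = \<epsilon>" using det_g0_nz by simp
  have e1: "2 * \<rho> x * partial_deriv 2 (\<lambda>x. h x $ 1 $ 1) x - h x $ 1 $ 1 * partial_deriv 2 \<rho> x
    = 2 * \<rho> x * partial_deriv 1 (\<lambda>x. h x $ 1 $ 2) x - h x $ 1 $ 2 * partial_deriv 1 \<rho> x"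
  proof -
    have "det_g0 * (2 * \<rho> x * partial_deriv 2 (\<lambda>x. h x $ 1 $ 1) x - h x $ 1 $ 1 * partial_deriv 2 \<rho> x)
       = det_g0 * (2 * \<rho> x * partial_deriv 1 (\<lambda>x. h x $ 1 $ 2) x - h x $ 1 $ 2 * partial_deriv 1 \<rho> x)"
      unfolding h' \<rho>' c using alg(1) k by algebra
    then show ?thesis using det_g0_nz by simp
  qed
  have e2: "2 * \<rho> x * partial_deriv 1 (\<lambda>x. h x $ 2 $ 2) x - h x $ 2 $ 2 * partial_deriv 1 \<rho> x
    = 2 * \<rho> x * partial_deriv 2 (\<lambda>x. h x $ 1 $ 2) x - h x $ 1 $ 2 * partial_deriv 2 \<rho> x"
  proof -
    have "det_g0 * (2 * \<rho> x * partial_deriv 1 (\<lambda>x. h x $ 2 $ 2) x - h x $ 2 $ 2 * partial_deriv 1 \<rho> x)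
       = det_g0 * (2 * \<rho> x * partial_deriv 2 (\<lambda>x. h x $ 1 $ 2) x - h x $ 1 $ 2 * partial_deriv 2 \<rho> x)"
      unfolding h' \<rho>' c using alg(2) k by algebra
    then show ?thesis using det_g0_nz by simp
  qed
  show "partial_deriv 2 (\<lambda>y. g y $ 1 $ 1) x = partial_deriv 1 (\<lambda>y. g y $ 1 $ 2) x"
    unfolding g' e1 ..
  show "partial_deriv 1 (\<lambda>y. g y $ 2 $ 2) x = partial_deriv 2 (\<lambda>y. g y $ 1 $ 2) x"
    unfolding g' e2 ..
qed

sublocale hessian_metric U g det_g0
proof
  show "open U" by (rule open_U)
  show "det_g0 \<noteq> 0" by (rule det_g0_nz)
  show s: "smooth_on U (\<lambda>x. g x $ \<alpha> $ \<beta>)" for \<alpha> \<beta>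
    by (rule smooth_on_cong[OF open_U smooth_on_mult[OF open_U smooth_\<sigma> smooth_h] g_eq])
  show sym: "g x $ \<alpha> $ \<beta> = g x $ \<beta> $ \<alpha>" for x \<alpha> \<beta>
    by (simp add: conformal_graph_metric_def h_sym[of x \<alpha> \<beta>])
  show "g x $ 1 $ 1 * g x $ 2 $ 2 - g x $ 1 $ 2 * g x $ 1 $ 2 = det_g0" if "x \<in> U" for x
    unfolding g_eq[OF that] using det_h[of x] \<sigma>_sq[OF that] by algebra
  show "partial_deriv \<gamma> (\<lambda>y. g y $ \<alpha> $ \<beta>) x = partial_deriv \<alpha> (\<lambda>y. g y $ \<gamma> $ \<beta>) x" if "x \<in> U" for x \<alpha> \<beta> \<gamma>
    using exhaust_2[of \<alpha>] exhaust_2[of \<beta>] exhaust_2[of \<gamma>] codazzi_12[OF that]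
    by (auto simp: sym[of _ 2 1])
qed

text \<open>
  The height function of a minimal surface is harmonic.
\<close>

lemma laplacian_\<phi>:
  assumes x: "x \<in> U"
  shows "laplacian \<phi> x = 0"
proof -
  have "g x $ 2 $ 2 * partial_deriv 1 (partial_deriv 1 \<phi>) x - 2 * g x $ 1 $ 2 * partial_deriv 1 (partial_deriv 2 \<phi>) x
    + g x $ 1 $ 1 * partial_deriv 2 (partial_deriv 2 \<phi>) x = 0"
    unfolding g_eq[OF x] using minimal_eq[OF x] by algebra
  then show ?thesis unfolding laplacian_explicit[OF x smooth_\<phi>] by simp
qed

end

section \<open>The Ricci-flat metric of a minimal graph\<close>

theorem mainTheorem1:
  fixes \<epsilon> :: real
    and g0 :: "real ^ 2 ^ 2"
    and U :: "(real ^ 2) set"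
    and \<phi> w1 w2 \<psi> \<Phi> :: "real ^ 2 \<Rightarrow> real"
    and e :: "'n::finite \<Rightarrow> real"
    and e0 m1 m2 n1 n2 :: real
  assumes "\<epsilon> \<in> {1, - 1}"
    and "transpose g0 = g0" and "invertible g0"
    and "open U" and "smooth_on U \<phi>"
    and "minimal_graph_on U \<epsilon> g0 \<phi>"
    and "\<And>x. x \<in> U \<Longrightarrow> w1 x = g0 $ 1 $ 1 + \<epsilon> * (partial_deriv 1 \<phi> x)\<^sup>2"
    and "\<And>x. x \<in> U \<Longrightarrow> w2 x = g0 $ 2 $ 2 + \<epsilon> * (partial_deriv 2 \<phi> x)\<^sup>2"
    and "\<And>x. x \<in> U \<Longrightarrow> graph_rho \<epsilon> g0 \<phi> x > 0"
    and "\<And>x. x \<in> U \<Longrightarrow> w1 x > 0" and "\<And>x. x \<in> U \<Longrightarrow> w2 x > 0"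
    and "\<And>k. e k \<in> {1, - 1}"
    and "m1 + m2 = 0"
    and "n1 + n2 = (real CARD('n) - 1) / 2"
    and "\<And>x. x \<in> U \<Longrightarrow>
           exp (2 * \<psi> x) =
             exp (2 * e0 * \<phi> x) * w1 x powr (- 2 * m1) * w2 x powr (- 2 * m2)"
    and "\<And>x. x \<in> U \<Longrightarrow>
           exp (2 * \<Phi> x) =
             exp (2 * \<psi> x) * w1 x powr (- 2 * n1) * w2 x powr (- 2 * n2)
               * graph_rho \<epsilon> g0 \<phi> x powr (n1 + n2)"
  shows "pseudo_riemannian_metric_on (cylinder U)
           (total_metric (conformal_graph_metric \<epsilon> g0 \<phi>) \<Phi> e)
       \<and> ricci_flat_on (cylinder U)
           (total_metric (conformal_graph_metric \<epsilon> g0 \<phi>) \<Phi> e)"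
proof -
  interpret minimal_graph \<epsilon> g0 U \<phi>
    by unfold_locales (use assms in auto)
  have E: "g x $ 1 $ 1 = \<sigma> x * w1 x" and G: "g x $ 2 $ 2 = \<sigma> x * w2 x" if "x \<in> U" for x
    using that by (simp_all add: g_eq h_eq assms(7,8) power2_eq_square)
  have \<sigma>_pos: "\<sigma> x > 0" for x by (simp add: \<sigma>_def)
  have pos: "g x $ 1 $ 1 > 0" "g x $ 2 $ 2 > 0" if "x \<in> U" for x
    using that assms(10,11) \<sigma>_pos by (simp_all add: E G)
  \<comment> \<open>The powers of \<open>\<rho>\<close> are exactly those that turn \<open>w1\<close> and \<open>w2\<close> into the diagonal entries of \<open>g\<close>.\<close>
  define \<Psi> where "\<Psi> x = e0 * \<phi> x - (m1 + n1) * ln (g x $ 1 $ 1) - (m2 + n2) * ln (g x $ 2 $ 2)" for x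
  have \<Phi>_eq: "\<Phi> x = \<Psi> x" if x: "x \<in> U" for x
  proof -
    have w: "w1 x > 0" "w2 x > 0" "\<rho> x > 0" using x assms(9,10,11) by auto
    have "exp (2 * \<Phi> x) = exp (2 * e0 * \<phi> x) * exp (- 2 * m1 * ln (w1 x)) * exp (- 2 * m2 * ln (w2 x))
        * exp (- 2 * n1 * ln (w1 x)) * exp (- 2 * n2 * ln (w2 x)) * exp ((n1 + n2) * ln (\<rho> x))"
      using w by (simp add: assms(15)[OF x] assms(16)[OF x] powr_def)
    then have "2 * \<Phi> x = 2 * e0 * \<phi> x + - 2 * m1 * ln (w1 x) + - 2 * m2 * ln (w2 x)
        + - 2 * n1 * ln (w1 x) + - 2 * n2 * ln (w2 x) + (n1 + n2) * ln (\<rho> x)"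
      unfolding exp_add[symmetric] by (rule exp_inj_iff[THEN iffD1])
    moreover have "ln (\<sigma> x) = - (1 / 2) * ln (\<rho> x)" by (simp add: \<sigma>_def)
    moreover have "ln (g x $ 1 $ 1) = ln (\<sigma> x) + ln (w1 x)" "ln (g x $ 2 $ 2) = ln (\<sigma> x) + ln (w2 x)"
      using w \<sigma>_pos[of x] by (simp_all add: E[OF x] G[OF x] ln_mult)
    ultimately show ?thesis
      using assms(13) unfolding \<Psi>_def by algebra
  qed
  have l: "smooth_on U (\<lambda>x. ln (g x $ \<mu> $ \<mu>))" for \<mu>
    using exhaust_2[of \<mu>] pos by (intro smooth_on_ln open_U smooth_g) auto
  have "smooth_on U \<Psi>"
    unfolding \<Psi>_def[abs_def]
    by (intro smooth_on_diff smooth_on_mult smooth_on_const open_U smooth_\<phi> l)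
  then have s: "smooth_on U \<Phi>"
    by (rule smooth_on_cong[OF open_U]) (rule \<Phi>_eq)
  have flat: "(1 - real CARD('n)) * christoffel_square \<alpha> \<beta> x = g x $ \<alpha> $ \<beta> * laplacian \<Phi> x" if x: "x \<in> U" for x \<alpha> \<beta>
  proof -
    define \<tau> where "\<tau> = christoffel_square 1 1 x / g x $ 1 $ 1"
    have E0: "g x $ 1 $ 1 \<noteq> 0" using pos[OF x] by simp
    have ln1: "laplacian (\<lambda>x. ln (g x $ 1 $ 1)) x = 2 * \<tau>" and ln2: "laplacian (\<lambda>x. ln (g x $ 2 $ 2)) x = 2 * \<tau>"
      unfolding \<tau>_def by (rule laplacian_ln_diag[OF x _ E0]; rule pos; assumption)+
    have "laplacian \<Phi> x = laplacian \<Psi> x" by (rule laplacian_cong[OF x \<Phi>_eq])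
    also have "\<dots> = - 2 * (m1 + n1 + (m2 + n2)) * \<tau>"
      unfolding \<Psi>_def[abs_def] laplacian_lincomb[OF x smooth_\<phi> l l] laplacian_\<phi>[OF x] ln1 ln2
      by algebra
    also have "\<dots> = (1 - real CARD('n)) * \<tau>"
    proof -
      have "2 * (n1 + n2) = real CARD('n) - 1" using assms(14) by simp
      with assms(13) show ?thesis by algebra
    qed
    finally have "laplacian \<Phi> x = (1 - real CARD('n)) * \<tau>" .
    then show ?thesis
      using christoffel_square_isotropic[OF x E0, of \<alpha> \<beta>] unfolding \<tau>_def[symmetric] by simp
  qed
  show ?thesis
    using pseudo_riemannian_total[OF s, of e] ricci_flat_total[OF s, of e] assms(12) flat by blast
qed

end
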